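(* Let $\beta$ be a solution of the $\mathrm{GL}(n)/\mathrm{O}(n)$-system with frame $E(x,\lambda)$. Let $\alpha\in\mathbb{R}\setminus\{0\}$ and let $N$ be an $n\times n$ matrix with $N^2=0$, $\overline N=N$, such that the matrix $N'$ and the matrices $\tilde N(x)$ and $\tilde{N'}(x)$ (all defined in the context) are well-defined. Then $$s_{\alpha,N}*\beta=\beta-(\tilde N+\tilde{N'})_*$$ is the solution of the $\mathrm{GL}(n)/\mathrm{O}(n)$-system obtained by dressing with $s_{\alpha,N}$; that is, it is a solution of the $\mathrm{GL}(n)/\mathrm{O}(n)$-system and $\hat E=s_{\alpha,N}*E$ satisfies $\hat E^{-1}d\hat E=\sum_i(\lambda a_i+[a_i,s_{\alpha,N}*\beta])\,dx_i$. Here $(A)_*$ denotes the off-diagonal part of a matrix $A$ (the matrix obtained by setting the diagonal entries equal to $0$).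
   Context: $\mathrm{GL}(n)/\mathrm{O}(n)$-system: let $a_i=e_{ii}$ be the diagonal matrix with $1$ at the $ii$-entry and $0$ elsewhere. A map $\beta=(\beta_{ij})$ from $\mathbb{R}^n$ (or an open subset) to real symmetric $n\times n$ matrices with zero diagonal is a solution if $[a_i,\beta_{x_j}]-[a_j,\beta_{x_i}]=[[a_i,\beta],[a_j,\beta]]$ for all $i,j$; equivalently $(\beta_{ij})_{x_k}=\beta_{ik}\beta_{kj}$ for $i,j,k$ distinct and $(\beta_{ij})_{x_i}+(\beta_{ij})_{x_j}+\sum_k\beta_{ik}\beta_{kj}=0$ for $i\neq j$; equivalently $\sum_i(\lambda a_i+[a_i,\beta])dx_i$ is flat for all $\lambda\in\mathbb{C}$. The frame of $\beta$ is the unique $E(x,\lambda)$ with $E^{-1}dE=\sum_i(\lambda a_i+[a_i,\beta])dx_i$ and $E(0,\lambda)=\mathrm{Id}$; it is holomorphic in $\lambda\in\mathbb{C}$. For a matrix $P$ with $P^2=0$ let $m_{\gamma,1,P}(\lambda)=\mathrm{Id}+\frac{1}{\lambda-\gamma}P$. Set $$N'=\left(\mathrm{Id}-\tfrac{1}{2\alpha}N\right)\left(\mathrm{Id}+\tfrac{1}{4\alpha^2}N^tN\right)^{-1}N^t\left(\mathrm{Id}+\tfrac{1}{2\alpha}N\right),\qquad s_{\alpha,N}=m_{-\alpha,1,N'}\,m_{\alpha,1,N}.$$ Put $E_1(x)=\left.\frac{d}{d\lambda}\right|_{\lambda=\alpha}E(x,\lambda)E(x,\alpha)^{-1}$ and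 $$\tilde N(x)=E(x,\alpha)^{-1}(\mathrm{Id}+NE_1(x))^{-1}NE(x,\alpha),\qquad \tilde E(x,\lambda)=m_{\alpha,1,N}(\lambda)E(x,\lambda)m_{\alpha,1,\tilde N(x)}(\lambda)^{-1},$$ then $\tilde E_1(x)=\left.\frac{d}{d\lambda}\right|_{\lambda=-\alpha}\tilde E(x,\lambda)\tilde E(x,-\alpha)^{-1}$ and $$\tilde{N'}(x)=\tilde E(x,-\alpha)^{-1}(\mathrm{Id}+N'\tilde E_1(x))^{-1}N'\tilde E(x,-\alpha).$$ "Well-defined" means that the inverses occurring exist (on the open set of $x$ under consideration, to which the conclusion refers). Dressing action: if $g_-$ is a matrix of rational functions of $\lambda$ with $g_-(\infty)=\mathrm{Id}$ and $g_+:\mathbb{C}\to\mathrm{GL}(n,\mathbb{C})$ is holomorphic, and $g_-g_+=\hat g_+\hat g_-$ with $\hat g_\pm$ of the same respective types, then $g_-*g_+:=\hat g_+$. Applied for each fixed $x$ to $E(x,\cdot)$, this gives $$\hat E=s_{\alpha,N}*E=m_{-\alpha,1,N'}\,m_{\alpha,1,N}\,E\,m_{\alpha,1,\tilde N}^{-1}\,m_{-\alpha,1,\tilde{N'}}^{-1}.$$ *)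

theory Defs
  imports "HOL-Analysis.Analysis" "HOL-Computational_Algebra.Polynomial"
begin

text \<open>
  All matrices are complex \<open>n \<times> n\<close> matrices, \<open>n = CARD('n)\<close>; reality of a solution is part of
  \<open>gl_o_solution\<close>. A complex scalar multiple of a matrix is written \<open>mat c ** A\<close>.
\<close>

subsection \<open>The GL(n)/O(n)-system\<close>

definition elem_diag :: "'n::finite \<Rightarrow> complex^'n^'n" where
  "elem_diag i = (\<chi> k l. if k = i \<and> l = i then 1 else 0)"

definition commutator :: "complex^'n^'n \<Rightarrow> complex^'n^'n \<Rightarrow> complex^'n^'n::finite" where
  "commutator A B = A ** B - B ** A"

definition off_diag :: "complex^'n^'n \<Rightarrow> complex^'n^'n::finite" where
  "off_diag A = (\<chi> i j. if i = j then 0 else A $ i $ j)"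

definition partial_deriv ::
  "'n \<Rightarrow> (real^'n \<Rightarrow> complex^'n^'n) \<Rightarrow> real^'n \<Rightarrow> complex^'n^'n::finite" where
  "partial_deriv j f x = frechet_derivative f (at x) (axis j 1)"

text \<open>Class \<open>C\<^sup>k\<close> on an open set \<open>U\<close>; smoothness is \<open>C_class k U f\<close> for all \<open>k\<close>.\<close>

primrec C_class ::
  "nat \<Rightarrow> (real^'n) set \<Rightarrow> (real^'n \<Rightarrow> complex^'n^'n::finite) \<Rightarrow> bool" where
  "C_class 0 U f \<longleftrightarrow> continuous_on U f"
| "C_class (Suc k) U f \<longleftrightarrow>
     (\<forall>x\<in>U. f differentiable (at x)) \<and> (\<forall>j. C_class k U (partial_deriv j f))"

definition gl_o_solution ::
  "nat \<Rightarrow> (real^'n) set \<Rightarrow> (real^'n \<Rightarrow> complex^'n^'n::finite) \<Rightarrow> bool" where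
  "gl_o_solution k U \<beta> \<longleftrightarrow>
     C_class k U \<beta> \<and>
     (\<forall>x\<in>U. (\<forall>i j. \<beta> x $ i $ j \<in> \<real>) \<and> transpose (\<beta> x) = \<beta> x \<and> (\<forall>i. \<beta> x $ i $ i = 0)) \<and>
     (\<forall>x\<in>U. \<forall>i j.
        commutator (elem_diag i) (partial_deriv j \<beta> x)
          - commutator (elem_diag j) (partial_deriv i \<beta> x)
        = commutator (commutator (elem_diag i) (\<beta> x)) (commutator (elem_diag j) (\<beta> x)))"

text \<open>The value at the tangent vector \<open>h\<close> of the one-form
  \<open>\<Sum>\<^sub>i (\<lambda> a\<^sub>i + [a\<^sub>i, \<beta>]) dx\<^sub>i\<close> at \<open>x\<close>.\<close>

definition lax_form ::
  "(real^'n \<Rightarrow> complex^'n^'n) \<Rightarrow> complex \<Rightarrow> real^'n \<Rightarrow> real^'n \<Rightarrow> complex^'n^'n::finite" where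
  "lax_form \<beta> l x h =
     (\<Sum>i\<in>UNIV. (h $ i) *\<^sub>R (mat l ** elem_diag i + commutator (elem_diag i) (\<beta> x)))"

text \<open>\<open>E\<^sup>-\<^sup>1 dE = \<Sum>\<^sub>i (\<lambda> a\<^sub>i + [a\<^sub>i, \<beta>]) dx\<^sub>i\<close> on \<open>U\<close>, for every \<open>\<lambda>\<close>.\<close>

definition has_lax_form ::
  "(real^'n) set \<Rightarrow> (real^'n \<Rightarrow> complex^'n^'n) \<Rightarrow>
   (real^'n \<Rightarrow> complex \<Rightarrow> complex^'n^'n::finite) \<Rightarrow> bool" where
  "has_lax_form U \<beta> E \<longleftrightarrow>
     (\<forall>x\<in>U. \<forall>l. invertible (E x l) \<and>
        (\<exists>D. ((\<lambda>y. E y l) has_derivative D) (at x) \<and>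
             (\<forall>h. matrix_inv (E x l) ** D h = lax_form \<beta> l x h)))"

definition entire_GL :: "(complex \<Rightarrow> complex^'n^'n::finite) \<Rightarrow> bool" where
  "entire_GL g \<longleftrightarrow> (\<forall>i j. (\<lambda>l. g l $ i $ j) holomorphic_on UNIV) \<and> (\<forall>l. invertible (g l))"

text \<open>The first and third conjunct already determine \<open>E\<close> on a connected \<open>U\<close> containing \<open>0\<close>,
  and imply holomorphy in \<open>\<lambda>\<close> when \<open>\<beta>\<close> is continuous.\<close>

definition is_frame ::
  "(real^'n) set \<Rightarrow> (real^'n \<Rightarrow> complex^'n^'n) \<Rightarrow>
   (real^'n \<Rightarrow> complex \<Rightarrow> complex^'n^'n::finite) \<Rightarrow> bool" where
  "is_frame U \<beta> E \<longleftrightarrow>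
     has_lax_form U \<beta> E \<and> (\<forall>x\<in>U. entire_GL (E x)) \<and> (\<forall>l. E 0 l = mat 1)"

subsection \<open>The dressing action\<close>

text \<open>A rational matrix function is represented by a total function whose values at finitely many
  points are irrelevant.\<close>

definition rational_normalized :: "(complex \<Rightarrow> complex^'n^'n::finite) \<Rightarrow> bool" where
  "rational_normalized g \<longleftrightarrow>
     (\<forall>i j. \<exists>p q. q \<noteq> 0 \<and> (\<forall>l. poly q l \<noteq> 0 \<longrightarrow> g l $ i $ j = poly p l / poly q l)) \<and>
     (g \<longlongrightarrow> mat 1) at_infinity"

text \<open>\<open>g\<^sub>- g\<^sub>+ = h\<^sub>+ h\<^sub>-\<close>, read as an identity of meromorphic functions; \<open>h\<^sub>+\<close> is unique by
  Liouville's theorem.\<close>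

definition dressing_factorization ::
  "(complex \<Rightarrow> complex^'n^'n) \<Rightarrow> (complex \<Rightarrow> complex^'n^'n) \<Rightarrow>
   (complex \<Rightarrow> complex^'n^'n) \<Rightarrow> (complex \<Rightarrow> complex^'n^'n::finite) \<Rightarrow> bool" where
  "dressing_factorization gm gp hp hm \<longleftrightarrow>
     rational_normalized gm \<and> entire_GL gp \<and> entire_GL hp \<and> rational_normalized hm \<and>
     (\<exists>S. finite S \<and> (\<forall>l. l \<notin> S \<longrightarrow> gm l ** gp l = hp l ** hm l))"

definition dress ::
  "(complex \<Rightarrow> complex^'n^'n) \<Rightarrow> (complex \<Rightarrow> complex^'n^'n) \<Rightarrow>
   complex \<Rightarrow> complex^'n^'n::finite" where
  "dress gm gp = (THE hp. \<exists>hm. dressing_factorization gm gp hp hm)"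

subsection \<open>The dressing matrices\<close>

text \<open>\<open>m\<^bsub>\<gamma>,1,P\<^esub>\<close>; its value at the pole \<open>\<gamma>\<close> is irrelevant.\<close>

definition simple_elem :: "complex \<Rightarrow> complex^'n^'n \<Rightarrow> complex \<Rightarrow> complex^'n^'n::finite" where
  "simple_elem \<gamma> P l = mat 1 + mat (1 / (l - \<gamma>)) ** P"

definition partner :: "real \<Rightarrow> complex^'n^'n \<Rightarrow> complex^'n^'n::finite" where
  "partner \<alpha> N =
     (mat 1 - (1 / (2 * \<alpha>)) *\<^sub>R N)
     ** matrix_inv (mat 1 + (1 / (4 * \<alpha>\<^sup>2)) *\<^sub>R (transpose N ** N))
     ** transpose N
     ** (mat 1 + (1 / (2 * \<alpha>)) *\<^sub>R N)"

definition dressing_elem :: "real \<Rightarrow> complex^'n^'n \<Rightarrow> complex \<Rightarrow> complex^'n^'n::finite" where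
  "dressing_elem \<alpha> N l =
     simple_elem (complex_of_real (- \<alpha>)) (partner \<alpha> N) l ** simple_elem (complex_of_real \<alpha>) N l"

text \<open>\<open>(d/d\<lambda>)\<^bsub>\<lambda>=\<gamma>\<^esub> F(\<lambda>) F(\<gamma>)\<^sup>-\<^sup>1\<close>, with the entrywise complex derivative.\<close>

definition log_deriv :: "complex \<Rightarrow> (complex \<Rightarrow> complex^'n^'n) \<Rightarrow> complex^'n^'n::finite" where
  "log_deriv \<gamma> F = (\<chi> i j. deriv (\<lambda>l. F l $ i $ j) \<gamma>) ** matrix_inv (F \<gamma>)"

text \<open>At a fixed \<open>x\<close>: \<open>N\<close> with tilde is \<open>dressed_nilp \<alpha> N (E x)\<close>, \<open>E\<close> with tilde is
  \<open>dressed_frame \<alpha> N (E x)\<close>, and \<open>N'\<close> with tilde is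
  \<open>dressed_nilp (-\<alpha>) N' (dressed_frame \<alpha> N (E x))\<close>.\<close>

definition dressed_nilp ::
  "complex \<Rightarrow> complex^'n^'n \<Rightarrow> (complex \<Rightarrow> complex^'n^'n) \<Rightarrow> complex^'n^'n::finite" where
  "dressed_nilp \<gamma> P F =
     matrix_inv (F \<gamma>) ** matrix_inv (mat 1 + P ** log_deriv \<gamma> F) ** P ** F \<gamma>"

definition dressed_frame ::
  "complex \<Rightarrow> complex^'n^'n \<Rightarrow> (complex \<Rightarrow> complex^'n^'n) \<Rightarrow>
   complex \<Rightarrow> complex^'n^'n::finite" where
  "dressed_frame \<gamma> P F l =
     simple_elem \<gamma> P l ** F l ** matrix_inv (simple_elem \<gamma> (dressed_nilp \<gamma> P F) l)"

end

theory Submission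
  imports Defs "HOL-Complex_Analysis.Cauchy_Integral_Formula"
begin

text \<open>
  A simple element with a nilpotent residue is dressed in one step: if \<open>Q = (1 + P E\<^sub>1)\<^sup>-\<^sup>1 P\<close> and
  \<open>N = E\<^sup>-\<^sup>1 Q E\<close> at the pole \<open>c\<close>, the identities \<open>PQ = QP = Q\<^sup>2 = 0\<close> and \<open>Q + P E\<^sub>1 Q = P\<close> say
  exactly that the polar parts of \<open>m\<^bsub>c,1,P\<^esub> E m\<^bsub>c,1,N\<^esub>\<^sup>-\<^sup>1\<close> and of its inverse cancel. Since
  \<open>dE\<^sub>1 = E (\<Sum>a\<^sub>i dx\<^sub>i) E\<^sup>-\<^sup>1\<close>, the matrix \<open>N\<close> solves the Riccati type equation
  \<open>dN = [N, \<theta>\<^sub>c] - N (\<Sum>a\<^sub>i dx\<^sub>i) N\<close>. This equation gives the smoothness of \<open>N\<close> by bootstrapping,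
  the form \<open>\<theta>\<close> of \<open>\<beta> - N\<close> for the dressed frame, and the nonlinear equations for \<open>\<beta> - N\<close>.
  Two such steps, at \<open>\<alpha>\<close> and at \<open>-\<alpha>\<close>, produce a solution of the system without reality conditions.
  The partner \<open>N'\<close> is chosen such that \<open>s(-\<lambda>)\<^sup>t s(\<lambda>) = 1\<close>. The frame has the same symmetry and is
  real, so by uniqueness of the factorization (Liouville) the factor on the right is also
  symmetric and real, and its residue at infinity \<open>N + N'\<close> (with tildes) is real symmetric.
\<close>

subsection \<open>Complex matrices\<close>

text \<open>A frame is differentiable in x for each fixed spectral parameter and holomorphic in the
  parameter for each fixed x; nothing is assumed jointly. Yet E_1, a derivative in the parameter,
  has to be differentiated in x, and the linear system of a dressed frame at its pole is a limit in
  the parameter. Both exchanges of limits rest on a Gronwall type bound, which makes convergence in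
  the parameter locally uniform in x. The set V may be disconnected and may miss 0, so symmetry and
  reality of the dressed frame cannot be propagated from an initial value. Only E is treated in this
  way, on U; the rest compares factorizations at one fixed x. The quotient 1/0 is 0, so the formula
  of a dressed frame has a spurious value at its pole. The proof works with the entire continuation
  \<open>ext\<close> and returns to the formula only away from the pole. The sum of the two dressed
  nilpotents may have a nonzero diagonal.\<close>

definition cscale :: "complex \<Rightarrow> complex^'n^'n \<Rightarrow> complex^'n^'n::finite" where
  "cscale c A = (\<chi> i j. c * A $ i $ j)"

lemma cscale_nth [simp]: "cscale c A $ i $ j = c * A $ i $ j"
  by (simp add: cscale_def)

lemma mat_mult_eq_cscale: "mat c ** A = cscale c A"
  by (simp add: vec_eq_iff matrix_matrix_mult_def mat_def if_distrib if_distribR cong: if_cong)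

lemma scaleR_eq_cscale: "r *\<^sub>R A = cscale (of_real r) A" for A :: "complex^'n^'n::finite"
  by (simp add: vec_eq_iff flip: scaleR_conv_of_real)

lemma cscale_simps [simp]:
  "cscale 0 A = 0" "cscale 1 A = A" "cscale c 0 = 0"
  "cscale c (cscale d A) = cscale (c * d) A"
  "cscale (- c) A = - cscale c A"
  "cscale c (- A) = - cscale c A"
  by (simp_all add: vec_eq_iff mult.assoc)

lemma cscale_distrib:
  "cscale c (A + B) = cscale c A + cscale c B"
  "cscale c (A - B) = cscale c A - cscale c B"
  by (simp_all add: vec_eq_iff algebra_simps)

lemma cscale_diff_left: "cscale (c - d) A = cscale c A - cscale d A"
  by (simp add: vec_eq_iff algebra_simps)

text \<open>The reason for \<open>cscale\<close>: a factor \<open>mat c\<close> would stay where it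
  is in a noncommutative product, whereas these rules move every scalar to the front.\<close>

lemma matrix_mult_cscale [simp]:
  "cscale c A ** B = cscale c (A ** B)"
  "A ** cscale c B = cscale c (A ** B)"
  by (simp_all add: vec_eq_iff matrix_matrix_mult_def sum_distrib_left algebra_simps)

lemma bounded_bilinear_matrix_mult:
  "bounded_bilinear (\<lambda>A B. (A :: complex^'n^'n) ** (B :: complex^'n^'n::finite))"
proof -
  have "(A + B) ** C = A ** C + B ** C" for A B C :: "complex^'n^'n"
    by (simp add: vec_eq_iff matrix_matrix_mult_def sum.distrib distrib_right)
  then show ?thesis
    by (simp flip: bilinear_conv_bounded_bilinear
        add: bilinear_def linear_iff matrix_add_ldistrib matrix_scalar_ac scalar_matrix_assoc)
qed

interpretation mm: bounded_bilinear "\<lambda>A B. (A :: complex^'n^'n) ** (B :: complex^'n^'n::finite)"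
  by (rule bounded_bilinear_matrix_mult)

lemma bounded_linear_cscale: "bounded_linear (cscale c)"
  unfolding mat_mult_eq_cscale[symmetric] by (rule mm.bounded_linear_right)

text \<open>Normal form: sums of right-associated words with scalars in front. A relation such as
  \<open>N ** N = 0\<close> must therefore also be supplied as \<open>N ** (N ** X) = 0\<close> to
  act inside longer words.\<close>

lemmas matrix_ring_simps =
  mm.add_left mm.add_right mm.diff_left mm.diff_right mm.minus_left mm.minus_right
  mm.zero_left mm.zero_right
  cscale_distrib matrix_mul_assoc[symmetric]

lemma bounded_linear_transpose:
  "bounded_linear (transpose :: complex^'n^'n \<Rightarrow> complex^'n^'n::finite)"
  unfolding linear_conv_bounded_linear[symmetric] linear_iff
  by (simp add: vec_eq_iff transpose_def)

lemmas transpose_simps =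
  bounded_linear_transpose[THEN bounded_linear.linear, THEN linear_add]
  bounded_linear_transpose[THEN bounded_linear.linear, THEN linear_diff]
  bounded_linear_transpose[THEN bounded_linear.linear, THEN linear_neg]
  bounded_linear_transpose[THEN bounded_linear.linear, THEN linear_0]
  matrix_transpose_mul

lemma transpose_cscale: "transpose (cscale c A) = cscale c (transpose A)"
  by (simp add: vec_eq_iff transpose_def)

abbreviation cnj_mat :: "complex^'n^'n \<Rightarrow> complex^'n^'n::finite" where
  "cnj_mat \<equiv> map_matrix cnj"

lemma bounded_linear_cnj_mat: "bounded_linear cnj_mat"
  unfolding linear_conv_bounded_linear[symmetric] linear_iff
  by (simp add: vec_eq_iff)

lemma cnj_mat_simps:
  "cnj_mat (A + B) = cnj_mat A + cnj_mat B"
  "cnj_mat (A - B) = cnj_mat A - cnj_mat B"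
  "cnj_mat (- A) = - cnj_mat A"
  "cnj_mat (A ** B) = cnj_mat A ** cnj_mat B"
  "cnj_mat (cscale c A) = cscale (cnj c) (cnj_mat A)"
  "cnj_mat (mat 1) = mat 1"
  "cnj_mat (transpose A) = transpose (cnj_mat A)"
  "cnj_mat (cnj_mat A) = A"
  by (simp_all add: vec_eq_iff matrix_matrix_mult_def mat_def transpose_def)

section \<open>Inverses and Cramer's rule\<close>

lemma matrix_inv_works:
  assumes "invertible A"
  shows "A ** matrix_inv A = mat 1" "matrix_inv A ** A = mat 1"
  using someI_ex[OF assms[unfolded invertible_def]] by (simp_all add: matrix_inv_def)

lemma matrix_inv_unique:
  fixes A B :: "complex^'n^'n::finite"
  assumes "A ** B = mat 1"
  shows "invertible A" "invertible B" "matrix_inv A = B" "B ** A = mat 1"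
proof -
  show BA: "B ** A = mat 1"
    using assms by (simp add: matrix_left_right_inverse)
  show A: "invertible A" and "invertible B"
    using assms BA by (auto simp: invertible_def)
  have "matrix_inv A = matrix_inv A ** (A ** B)"
    by (simp add: assms)
  also have "\<dots> = B"
    by (simp add: matrix_mul_assoc matrix_inv_works[OF A])
  finally show "matrix_inv A = B" .
qed

lemma matrix_inv_mult_cancel:
  fixes A :: "complex^'n^'n::finite"
  assumes "invertible A"
  shows "A ** (matrix_inv A ** B) = B" "matrix_inv A ** (A ** B) = B"
  using matrix_inv_works[OF assms] by (simp_all add: matrix_mul_assoc)

text \<open>Cramer's rule for column j of the inverse. Writing the entries as quotients of
  determinants gives differentiability, continuity and holomorphy of inverses from the same
  formula.\<close>

lemma matrix_inv_nth:
  fixes A :: "complex^'n^'n::finite"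
  assumes "invertible A"
  shows "matrix_inv A $ k $ j
    = det (\<chi> i m. if m = k then axis j 1 $ i else A $ i $ m) / det A"
proof -
  have "det A \<noteq> 0"
    using assms invertible_det_nz by blast
  moreover have "A *v column j (matrix_inv A) = axis j 1"
  proof -
    have "(A *v column j (matrix_inv A)) $ i = (A ** matrix_inv A) $ i $ j" for i
      by (simp add: matrix_vector_mult_def matrix_matrix_mult_def column_def)
    then show ?thesis
      by (simp add: matrix_inv_works[OF assms] vec_eq_iff mat_def axis_def)
  qed
  ultimately have "column j (matrix_inv A)
      = (\<chi> k. det (\<chi> i m. if m = k then axis j 1 $ i else A $ i $ m) / det A)"
    using cramer by blast
  then show ?thesis
    by (auto simp: vec_eq_iff column_def)
qed

section \<open>Differentiability and limits of determinants and inverses\<close>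

lemma matrix_differentiable_iff:
  fixes f :: "'a::real_normed_vector \<Rightarrow> complex^'n^'n::finite"
  shows "f differentiable (at x within S) \<longleftrightarrow> (\<forall>i j. (\<lambda>x. f x $ i $ j) differentiable (at x within S))"
proof
  assume "f differentiable (at x within S)"
  then obtain D where D: "(f has_derivative D) (at x within S)"
    unfolding differentiable_def by blast
  have "((\<lambda>x. f x $ i $ j) has_derivative (\<lambda>h. D h $ i $ j)) (at x within S)" for i j
    by (intro bounded_linear.has_derivative[OF bounded_linear_vec_nth] D)
  then show "\<forall>i j. (\<lambda>x. f x $ i $ j) differentiable (at x within S)"
    unfolding differentiable_def by blast
next
  assume "\<forall>i j. (\<lambda>x. f x $ i $ j) differentiable (at x within S)"
  then have "(\<lambda>x. f x $ i $ j \<bullet> u) differentiable (at x within S)" for i j u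
    unfolding differentiable_def
    using bounded_linear.has_derivative[OF bounded_linear_inner_left[of u]] by blast
  then show "f differentiable (at x within S)"
    by (subst differentiable_componentwise_within) (auto simp: Basis_vec_def inner_axis)
qed

lemma differentiable_prod:
  fixes f :: "'i \<Rightarrow> 'a::real_normed_vector \<Rightarrow> 'b::real_normed_field"
  assumes "\<And>i. i \<in> I \<Longrightarrow> f i differentiable (at x within S)"
  shows "(\<lambda>x. \<Prod>i\<in>I. f i x) differentiable (at x within S)"
  using assms
proof (induction I rule: infinite_finite_induct)
  case (insert i I)
  then have "(\<lambda>x. f i x * (\<Prod>i\<in>I. f i x)) differentiable (at x within S)"
    by (intro differentiable_mult) simp_all
  then show ?case
    by (simp only: prod.insert[OF insert.hyps(1,2)])
qed simp_all

lemma differentiable_det: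
  fixes f :: "'a::real_normed_vector \<Rightarrow> complex^'n^'n::finite"
  assumes "\<And>i j. (\<lambda>x. f x $ i $ j) differentiable (at x within S)"
  shows "(\<lambda>x. det (f x)) differentiable (at x within S)"
proof -
  have "(\<lambda>x. of_int (sign p) * (\<Prod>i\<in>UNIV. f x $ i $ p i)) differentiable (at x within S)" for p
    by (rule differentiable_mult[OF differentiable_const differentiable_prod[OF assms]])
  then show ?thesis
    unfolding det_def by (intro differentiable_sum ballI) (simp_all add: finite_permutations)
qed

text \<open>Cramer's rule, valid on all of V, shows that some derivative exists; its value is then
  forced by differentiating the constant product of \<open>f y\<close> and its inverse.\<close>

lemma has_derivative_matrix_inv:
  fixes f :: "'a::real_normed_vector \<Rightarrow> complex^'n^'n::finite"
  assumes V: "open V" "x \<in> V" and inv: "\<And>y. y \<in> V \<Longrightarrow> invertible (f y)"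
    and f: "(f has_derivative f') (at x)"
  shows "((\<lambda>y. matrix_inv (f y)) has_derivative
           (\<lambda>h. - (matrix_inv (f x) ** f' h ** matrix_inv (f x)))) (at x)"
proof -
  let ?c = "\<lambda>k j y. det (\<chi> i m. if m = k then axis j 1 $ i else f y $ i $ m) / det (f y)"
  have "f differentiable (at x)"
    using f by (auto simp: differentiable_def)
  then have fd: "(\<lambda>x. f x $ i $ j) differentiable (at x)" for i j
    by (simp add: matrix_differentiable_iff)
  have "?c k j differentiable (at x)" for k j
  proof (intro differentiable_divide differentiable_det fd)
    show "(\<lambda>x. (\<chi> i m. if m = k then axis j 1 $ i else f x $ i $ m) $ i' $ j') differentiable (at x)"
      for i' j' by (cases "j' = k") (simp_all add: fd)
    show "det (f x) \<noteq> 0"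
      using inv[OF V(2)] invertible_det_nz by blast
  qed
  then have "(\<lambda>y. matrix_inv (f y) $ k $ j) differentiable (at x)" for k j
  proof -
    assume "\<And>k j. ?c k j differentiable (at x)"
    then obtain D where D: "(?c k j has_derivative D) (at x)"
      unfolding differentiable_def by blast
    have "((\<lambda>y. matrix_inv (f y) $ k $ j) has_derivative D) (at x)"
      by (rule has_derivative_transform_within_open[OF D V]) (simp add: matrix_inv_nth inv)
    then show ?thesis
      unfolding differentiable_def by blast
  qed
  then have "(\<lambda>y. matrix_inv (f y)) differentiable (at x)"
    by (simp add: matrix_differentiable_iff)
  then obtain D where D: "((\<lambda>y. matrix_inv (f y)) has_derivative D) (at x)"
    unfolding differentiable_def by blast
  have "((\<lambda>y. f y ** matrix_inv (f y)) has_derivative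
      (\<lambda>h. f x ** D h + f' h ** matrix_inv (f x))) (at x)"
    by (rule mm.FDERIV[OF f D])
  moreover have "((\<lambda>y. f y ** matrix_inv (f y)) has_derivative (\<lambda>h. 0)) (at x)"
    by (rule has_derivative_transform_within_open[OF has_derivative_const[of "mat 1"] V])
      (simp add: matrix_inv_works inv)
  ultimately have "(\<lambda>h. f x ** D h + f' h ** matrix_inv (f x)) = (\<lambda>h. 0)"
    by (rule has_derivative_unique)
  then have "f x ** D h + f' h ** matrix_inv (f x) = 0" for h
    by (rule fun_cong)
  then have "matrix_inv (f x) ** (f x ** D h + f' h ** matrix_inv (f x)) = 0" for h
    by (simp add: mm.zero_right)
  then have "D h + matrix_inv (f x) ** f' h ** matrix_inv (f x) = 0" for h
    by (simp add: mm.add_right matrix_inv_mult_cancel[OF inv[OF V(2)]] matrix_mul_assoc[symmetric])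
  then have "D = (\<lambda>h. - (matrix_inv (f x) ** f' h ** matrix_inv (f x)))"
    by (simp add: fun_eq_iff eq_neg_iff_add_eq_0)
  with D show ?thesis by (simp only:)
qed

lemma tendsto_matrix_inv:
  fixes f :: "'a \<Rightarrow> complex^'n^'n::finite"
  assumes f: "(f \<longlongrightarrow> A) F" and A: "invertible A"
  shows "((\<lambda>x. matrix_inv (f x)) \<longlongrightarrow> matrix_inv A) F"
    and "eventually (\<lambda>x. invertible (f x)) F"
proof -
  have fn: "((\<lambda>x. f x $ i $ j) \<longlongrightarrow> A $ i $ j) F" for i j
    by (intro tendsto_vec_nth f)
  have det: "((\<lambda>x. det (g x)) \<longlongrightarrow> det B) F"
    if "\<And>i j. ((\<lambda>x. g x $ i $ j) \<longlongrightarrow> B $ i $ j) F" for g and B :: "complex^'n^'n"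
    unfolding det_def by (intro tendsto_intros that)
  have nz: "det A \<noteq> 0"
    using A invertible_det_nz by blast
  show ev: "eventually (\<lambda>x. invertible (f x)) F"
    using tendsto_imp_eventually_ne[OF det[OF fn] nz] by (simp add: invertible_det_nz)
  show "((\<lambda>x. matrix_inv (f x)) \<longlongrightarrow> matrix_inv A) F"
  proof (intro vec_tendstoI)
    fix k j
    have "((\<lambda>x. det (\<chi> i m. if m = k then axis j 1 $ i else f x $ i $ m) / det (f x))
        \<longlongrightarrow> det (\<chi> i m. if m = k then axis j 1 $ i else A $ i $ m) / det A) F"
      by (intro tendsto_divide det fn nz) (simp add: fn)
    moreover have "eventually (\<lambda>x. det (\<chi> i m. if m = k then axis j 1 $ i else f x $ i $ m)
        / det (f x) = matrix_inv (f x) $ k $ j) F"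
      using ev by eventually_elim (simp add: matrix_inv_nth)
    ultimately show "((\<lambda>x. matrix_inv (f x) $ k $ j) \<longlongrightarrow> matrix_inv A $ k $ j) F"
      unfolding matrix_inv_nth[OF A] by (rule Lim_transform_eventually)
  qed
qed

section \<open>Entire matrix functions, not necessarily invertible\<close>

definition entire_matrix :: "(complex \<Rightarrow> complex^'n^'n::finite) \<Rightarrow> bool" where
  "entire_matrix g \<longleftrightarrow> (\<forall>i j. (\<lambda>l. g l $ i $ j) holomorphic_on UNIV)"

lemma entire_matrix_const: "entire_matrix (\<lambda>l. A)"
  by (simp add: entire_matrix_def)

lemma entire_matrix_add: "entire_matrix f \<Longrightarrow> entire_matrix g \<Longrightarrow> entire_matrix (\<lambda>l. f l + g l)"
  by (simp add: entire_matrix_def holomorphic_on_add holomorphic_on_diff)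

lemma entire_matrix_diff: "entire_matrix f \<Longrightarrow> entire_matrix g \<Longrightarrow> entire_matrix (\<lambda>l. f l - g l)"
  by (simp add: entire_matrix_def holomorphic_on_add holomorphic_on_diff)

lemma entire_matrix_mult: "entire_matrix f \<Longrightarrow> entire_matrix g \<Longrightarrow> entire_matrix (\<lambda>l. f l ** g l)"
  by (simp add: entire_matrix_def matrix_matrix_mult_def holomorphic_on_sum holomorphic_on_mult)

lemma holomorphic_on_det:
  fixes f :: "complex \<Rightarrow> complex^'n^'n::finite"
  assumes "\<And>i j. (\<lambda>l. f l $ i $ j) holomorphic_on S"
  shows "(\<lambda>l. det (f l)) holomorphic_on S"
  unfolding det_def by (intro holomorphic_intros assms)

lemma entire_matrix_inv:
  assumes "entire_matrix f" and inv: "\<And>l. invertible (f l)"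
  shows "entire_matrix (\<lambda>l. matrix_inv (f l))"
  unfolding entire_matrix_def matrix_inv_nth[OF inv]
proof (intro allI holomorphic_on_divide holomorphic_on_det)
  have fh: "(\<lambda>l. f l $ i $ j) holomorphic_on UNIV" for i j
    using assms(1) by (simp add: entire_matrix_def)
  show "(\<lambda>l. f l $ i $ j) holomorphic_on UNIV" for i j
    by (rule fh)
  show "(\<lambda>l. (\<chi> i m. if m = k then axis j 1 $ i else f l $ i $ m) $ p $ q) holomorphic_on UNIV"
    for k j p q
    by (cases "q = k") (simp_all add: fh)
  show "det (f l) \<noteq> 0" for l
    using inv invertible_det_nz by blast
qed

lemma entire_GL_iff: "entire_GL g \<longleftrightarrow> entire_matrix g \<and> (\<forall>l. invertible (g l))"
  by (simp add: entire_GL_def entire_matrix_def)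

lemma entire_matrix_tendsto:
  assumes "entire_matrix g"
  shows "(g \<longlongrightarrow> g l) (at l)"
proof (intro vec_tendstoI)
  fix i j
  have "(\<lambda>l. g l $ i $ j) holomorphic_on UNIV"
    using assms by (simp add: entire_matrix_def)
  then have "continuous_on UNIV (\<lambda>l. g l $ i $ j)"
    by (rule holomorphic_on_imp_continuous_on)
  then show "((\<lambda>x. g x $ i $ j) \<longlongrightarrow> g l $ i $ j) (at l)"
    by (simp add: continuous_on_def)
qed

lemma Liouville_matrix:
  assumes "entire_matrix g" "(g \<longlongrightarrow> A) at_infinity"
  shows "g l = A"
proof -
  have "g l $ i $ j = A $ i $ j" for i j
    using assms by (intro Liouville_weak[of "\<lambda>l. g l $ i $ j"] tendsto_vec_nth)
      (simp_all add: entire_matrix_def)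
  then show ?thesis by (simp add: vec_eq_iff)
qed

subsection \<open>Solutions of the linear system\<close>

text \<open>The form sum_i a_i dx_i evaluated at h. With it the Lax form becomes an expression in a
  single diagonal matrix instead of a sum over coordinates.\<close>

definition dg :: "real^'n \<Rightarrow> complex^'n^'n::finite" where
  "dg h = (\<chi> i j. if i = j then of_real (h $ i) else 0)"

lemma bounded_linear_dg: "bounded_linear dg"
  unfolding linear_conv_bounded_linear[symmetric] linear_iff
  by (simp add: vec_eq_iff dg_def scaleR_conv_of_real[symmetric])

lemma dg_axis: "dg (axis j 1) = elem_diag j"
  by (auto simp: vec_eq_iff dg_def elem_diag_def axis_def)

lemma transpose_dg [simp]: "transpose (dg h) = dg h"
  by (simp add: vec_eq_iff dg_def transpose_def)

lemma cnj_mat_dg [simp]: "cnj_mat (dg h) = dg h"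
  by (simp add: vec_eq_iff dg_def)

lemma dg_mult_nth: "(dg h ** A) $ i $ j = of_real (h $ i) * A $ i $ j"
  and mult_dg_nth: "(A ** dg h) $ i $ j = of_real (h $ j) * A $ i $ j"
proof -
  have "(dg h ** A) $ i $ j = (\<Sum>k\<in>UNIV. if i = k then of_real (h $ k) * A $ k $ j else 0)"
    unfolding dg_def matrix_matrix_mult_def vec_lambda_beta by (rule sum.cong) auto
  then show "(dg h ** A) $ i $ j = of_real (h $ i) * A $ i $ j" by simp
  have "(A ** dg h) $ i $ j = (\<Sum>k\<in>UNIV. if j = k then of_real (h $ k) * A $ i $ k else 0)"
    unfolding dg_def matrix_matrix_mult_def vec_lambda_beta by (rule sum.cong) auto
  then show "(A ** dg h) $ i $ j = of_real (h $ j) * A $ i $ j" by simp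
qed

lemma dg_commute: "dg h ** dg k = dg k ** dg h" for h k :: "real^'n::finite"
  by (simp add: vec_eq_iff dg_mult_nth) (simp add: dg_def)

lemma dg_eq_sum: "dg h = (\<Sum>i\<in>UNIV. (h $ i) *\<^sub>R elem_diag i)"
proof -
  have "(h $ i) *\<^sub>R elem_diag i $ k $ l = (if i = k then if k = l then of_real (h $ k) else 0 else 0)"
    for i k l by (auto simp: elem_diag_def scaleR_conv_of_real)
  then show ?thesis
    by (simp add: vec_eq_iff dg_def)
qed

lemma lax_form_eq: "lax_form B l x h = cscale l (dg h) + commutator (dg h) (B x)"
proof -
  have "(h $ i) *\<^sub>R (mat l ** elem_diag i + commutator (elem_diag i) (B x))
      = cscale l ((h $ i) *\<^sub>R elem_diag i)
        + (((h $ i) *\<^sub>R elem_diag i) ** B x - B x ** ((h $ i) *\<^sub>R elem_diag i))" for i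
    by (simp add: scaleR_eq_cscale mat_mult_eq_cscale commutator_def cscale_distrib mult.commute)
  then have "lax_form B l x h = (\<Sum>i\<in>UNIV. cscale l ((h $ i) *\<^sub>R elem_diag i))
      + ((\<Sum>i\<in>UNIV. ((h $ i) *\<^sub>R elem_diag i) ** B x) - (\<Sum>i\<in>UNIV. B x ** ((h $ i) *\<^sub>R elem_diag i)))"
    unfolding lax_form_def by (simp only: sum.distrib sum_subtractf)
  then show ?thesis
    unfolding commutator_def dg_eq_sum mm.sum_left mm.sum_right
      linear_sum[OF bounded_linear.linear[OF bounded_linear_cscale]] .
qed

text \<open>The system as dF = F theta, with holomorphy in the parameter built in and without a
  normalization at 0, because dressed frames live on a set that need not contain 0.\<close>

definition lax_solution ::
  "(real^'n) set \<Rightarrow> (real^'n \<Rightarrow> complex^'n^'n) \<Rightarrow>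
   (real^'n \<Rightarrow> complex \<Rightarrow> complex^'n^'n::finite) \<Rightarrow> bool" where
  "lax_solution V B F \<longleftrightarrow>
     (\<forall>x\<in>V. entire_GL (F x) \<and>
       (\<forall>l. ((\<lambda>y. F y l) has_derivative (\<lambda>h. F x l ** lax_form B l x h)) (at x)))"

lemma has_lax_form_iff:
  "(\<forall>x\<in>V. entire_GL (F x)) \<Longrightarrow> has_lax_form V B F \<longleftrightarrow> lax_solution V B F"
proof -
  assume e: "\<forall>x\<in>V. entire_GL (F x)"
  have "(invertible (F x l) \<and> (\<exists>D. ((\<lambda>y. F y l) has_derivative D) (at x) \<and>
           (\<forall>h. matrix_inv (F x l) ** D h = lax_form B l x h))) \<longleftrightarrow>
        ((\<lambda>y. F y l) has_derivative (\<lambda>h. F x l ** lax_form B l x h)) (at x)" (is "?L \<longleftrightarrow> ?R")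
    if x: "x \<in> V" for x l
  proof -
    have inv: "invertible (F x l)"
      using e x by (auto simp: entire_GL_def)
    have "matrix_inv (F x l) ** D h = lax_form B l x h \<longleftrightarrow> D h = F x l ** lax_form B l x h" for D h
      by (metis inv matrix_inv_mult_cancel)
    then show ?thesis
      using inv by (auto simp flip: fun_eq_iff)
  qed
  then show ?thesis
    using e unfolding has_lax_form_def lax_solution_def by blast
qed

text \<open>A Gronwall type estimate: on a ball that is small compared to the Lipschitz constant \<open>C\<close>
  it follows from the mean value inequality at a maximum of \<open>norm f\<close>.\<close>

lemma norm_le_on_small_ball:
  fixes f :: "'a::euclidean_space \<Rightarrow> 'b::real_normed_vector"
  assumes der: "\<And>x. x \<in> cball x0 r \<Longrightarrow> (f has_derivative f' x) (at x)"
    and le: "\<And>x h. x \<in> cball x0 r \<Longrightarrow> norm (f' x h) \<le> (C * norm (f x) + D) * norm h"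
    and C: "0 \<le> C" "C * r \<le> 1/2" and D: "0 \<le> D" and x: "x \<in> cball x0 r"
  shows "norm (f x) \<le> 2 * (norm (f x0) + D * r)"
proof -
  have r: "0 \<le> r"
    using x by (metis cball_empty empty_iff not_le)
  have "continuous_on (cball x0 r) f"
    using der by (meson continuous_at_imp_continuous_on has_derivative_continuous)
  then have "continuous_on (cball x0 r) (\<lambda>x. norm (f x))"
    by (rule continuous_on_norm)
  then obtain m where m: "m \<in> cball x0 r" and max: "\<And>x. x \<in> cball x0 r \<Longrightarrow> norm (f x) \<le> norm (f m)"
    using continuous_attains_sup[of "cball x0 r" "\<lambda>x. norm (f x)"] x by (metis compact_cball empty_iff)
  have "norm (f m - f x0) \<le> (C * norm (f m) + D) * norm (m - x0)"
  proof (rule differentiable_bound[where S = "cball x0 r"])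
    fix x assume x: "x \<in> cball x0 r"
    show "(f has_derivative f' x) (at x within cball x0 r)"
      by (rule has_derivative_at_withinI[OF der[OF x]])
    show "onorm (f' x) \<le> C * norm (f m) + D"
    proof (rule onorm_le)
      fix h
      have "norm (f' x h) \<le> (C * norm (f x) + D) * norm h"
        by (rule le[OF x])
      also have "\<dots> \<le> (C * norm (f m) + D) * norm h"
        by (intro mult_right_mono add_right_mono mult_left_mono max x C) simp
      finally show "norm (f' x h) \<le> (C * norm (f m) + D) * norm h" .
    qed
  qed (use m r in auto)
  also have "\<dots> \<le> (C * norm (f m) + D) * r"
    using m C D by (intro mult_left_mono) (auto simp: dist_norm norm_minus_commute)
  also have "\<dots> = (C * r) * norm (f m) + D * r"
    by (simp add: algebra_simps)
  also have "\<dots> \<le> 1/2 * norm (f m) + D * r"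
    by (intro add_right_mono mult_right_mono C) simp
  finally have "norm (f m) \<le> norm (f x0) + 1/2 * norm (f m) + D * r"
    using norm_triangle_sub[of "f m" "f x0"] by linarith
  with max[OF x] show ?thesis by simp
qed

lemma tendsto_mat:
  assumes "(f \<longlongrightarrow> c) F"
  shows "((\<lambda>x. mat (f x) :: complex^'n^'n::finite) \<longlongrightarrow> mat c) F"
proof (intro vec_tendstoI)
  fix i j
  show "((\<lambda>x. (mat (f x) :: complex^'n^'n) $ i $ j) \<longlongrightarrow> mat c $ i $ j) F"
    using assms by (cases "i = j") (simp_all add: mat_def)
qed

text \<open>Pointwise convergence improves itself to uniform convergence on a small ball. The
  difference of two solutions satisfies a linear equation whose inhomogeneity is proportional to the
  distance of the parameters, so \<open>norm_le_on_small_ball\<close> controls it by its value at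
  the centre plus that distance. The limit in the second index then gives the bound against
  \<open>T0\<close>.\<close>

lemma lax_solutions_uniform_limit:
  fixes T :: "nat \<Rightarrow> real^'n::finite \<Rightarrow> complex^'n^'n" and B :: "real^'n \<Rightarrow> complex^'n^'n"
  assumes V: "open V" "x0 \<in> V" and B: "continuous_on V B" and l: "l \<longlonglongrightarrow> l0"
    and der: "\<And>n x. x \<in> V \<Longrightarrow> (T n has_derivative (\<lambda>h. T n x ** lax_form B (l n) x h)) (at x)"
    and lim: "\<And>x. x \<in> V \<Longrightarrow> (\<lambda>n. T n x) \<longlonglongrightarrow> T0 x"
  shows "\<exists>r C M. r > 0 \<and> cball x0 r \<subseteq> V \<and>
    (\<forall>x\<in>cball x0 r. \<forall>h n. norm (lax_form B (l n) x h) \<le> C * norm h) \<and>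
    (\<forall>x\<in>cball x0 r. norm (T0 x) \<le> M) \<and>
    (\<forall>e>0. \<forall>\<^sub>F n in sequentially. \<forall>x\<in>cball x0 r. norm (T n x - T0 x) \<le> e)"
proof -
  have "\<exists>K>0. \<forall>(X :: complex^'n^'n) (Y :: complex^'n^'n). norm (X ** Y) \<le> norm X * norm Y * K"
    by (rule mm.pos_bounded)
  then obtain K where K: "K > 0" "\<And>(X :: complex^'n^'n) (Y :: complex^'n^'n). norm (X ** Y) \<le> norm X * norm Y * K"
    by auto
  have "\<exists>d>0. \<forall>h :: real^'n. norm (dg h) \<le> norm h * d"
    by (rule bounded_linear.pos_bounded[OF bounded_linear_dg])
  then obtain d where d: "d > 0" "\<And>h :: real^'n. norm (dg h) \<le> norm h * d"
    by auto
  have matl: "(\<lambda>n. mat (l n) :: complex^'n^'n) \<longlonglongrightarrow> mat l0"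
    by (rule tendsto_mat[OF l])
  obtain L where L: "\<And>n. norm (mat (l n) :: complex^'n^'n) \<le> L"
    using convergent_imp_Bseq[OF convergentI[OF matl]] by (metis BseqE)
  have L0: "0 \<le> L"
    using L[of 0] norm_ge_zero order_trans by blast
  obtain r0 where r0: "r0 > 0" "cball x0 r0 \<subseteq> V"
    using V open_contains_cball by blast
  have "bounded (B ` cball x0 r0)"
    by (intro compact_imp_bounded compact_continuous_image continuous_on_subset[OF B] r0) auto
  then obtain b where b: "b > 0" "\<And>x. x \<in> cball x0 r0 \<Longrightarrow> norm (B x) \<le> b"
    unfolding bounded_pos by blast
  define C0 where "C0 = (L + 2 * b) * d * K"
  define C where "C = C0 * K"
  have C0: "0 \<le> C0" and C: "0 \<le> C"
    using K d b L0 by (simp_all add: C_def C0_def)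
  have lax: "norm (lax_form B (l n) x h) \<le> C0 * norm h" if x: "x \<in> cball x0 r0" for x h n
  proof -
    have "norm (lax_form B (l n) x h)
        \<le> norm (mat (l n) ** dg h) + (norm (dg h ** B x) + norm (B x ** dg h))"
      unfolding lax_form_eq mat_mult_eq_cscale[symmetric] commutator_def
      by (rule order_trans[OF norm_triangle_ineq add_left_mono[OF norm_triangle_ineq4]])
    also have "\<dots> \<le> L * (norm h * d) * K + ((norm h * d) * b * K + b * (norm h * d) * K)"
      using b(2)[OF x] L[of n] K(1) d b(1) L0
      by (intro add_mono order_trans[OF K(2)] mult_right_mono mult_mono) auto
    also have "\<dots> = C0 * norm h"
      by (simp add: C0_def algebra_simps)
    finally show ?thesis .
  qed
  \<comment> \<open>The smallness \<open>C * r \<le> 1/2\<close> is what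
    \<open>norm_le_on_small_ball\<close> asks for; the summand 1 covers the case
    \<open>C = 0\<close>.\<close>
  define r where "r = min r0 (1 / (2 * (C + 1)))"
  have r: "r > 0" "r \<le> r0" "C * r \<le> 1/2"
  proof -
    show "r > 0" "r \<le> r0"
      using r0 C by (auto simp: r_def)
    have "C * r \<le> C * (1 / (2 * (C + 1)))"
      by (intro mult_left_mono C) (simp add: r_def)
    also have "\<dots> \<le> 1/2"
      using C by (simp add: field_simps)
    finally show "C * r \<le> 1/2" .
  qed
  have sub: "cball x0 r \<subseteq> cball x0 r0"
    using r by auto
  have inV: "x \<in> V" if "x \<in> cball x0 r" for x
    using that sub r0 by blast
  have mult_lax: "norm (X ** lax_form B (l n) x h) \<le> C * norm X * norm h"
    if "x \<in> cball x0 r" for X :: "complex^'n^'n" and x h n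
  proof -
    have "norm (X ** lax_form B (l n) x h) \<le> norm X * (C0 * norm h) * K"
      using lax[of x n h] that sub K(1)
      by (intro order_trans[OF K(2)] mult_right_mono mult_left_mono) auto
    then show ?thesis by (simp add: C_def mult_ac)
  qed
  obtain M0 where M0: "\<And>n. norm (T n x0) \<le> M0"
    using convergent_imp_Bseq[OF convergentI[OF lim[OF V(2)]]] by (metis BseqE)
  have bound: "norm (T n x) \<le> 2 * M0" if x: "x \<in> cball x0 r" for n x
  proof -
    have "norm (T n x) \<le> 2 * (norm (T n x0) + 0 * r)"
      by (rule norm_le_on_small_ball[OF der _ C r(3) order_refl x])
        (auto simp: inV simp del: mem_cball intro: mult_lax)
    with M0[of n] show ?thesis by simp
  qed
  have M0': "0 \<le> M0"
    using M0[of 0] norm_ge_zero order_trans by blast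
  have bound0: "norm (T0 x) \<le> 2 * M0" if x: "x \<in> cball x0 r" for x
    by (rule tendsto_upperbound[OF tendsto_norm[OF lim[OF inV[OF x]]]]) (simp_all add: bound x del: mem_cball)
  \<comment> \<open>Bound, per unit of \<open>norm h\<close>, for the inhomogeneity in the equation
    of \<open>T n - T m\<close>; the factor \<open>2 * M0\<close> is the uniform bound of the
    solutions.\<close>
  define D where "D = (\<lambda>n m. 2 * M0 * (norm (mat (l n) - mat (l m) :: complex^'n^'n) * d * K) * K)"
  have diff: "norm (T n x - T m x) \<le> 2 * (norm (T n x0 - T m x0) + D n m * r)"
    if x: "x \<in> cball x0 r" for n m x
  proof (rule norm_le_on_small_ball[where f = "\<lambda>x. T n x - T m x", OF _ _ C r(3) _ x])
    fix x h assume x: "x \<in> cball x0 r"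
    show "((\<lambda>x. T n x - T m x) has_derivative
        (\<lambda>h. T n x ** lax_form B (l n) x h - T m x ** lax_form B (l m) x h)) (at x)"
      by (intro has_derivative_diff der inV x)
    \<comment> \<open>The two Lax forms share their bracket part, so they differ only by the
      difference of the parameters times \<open>dg h\<close>.\<close>
    have "T n x ** lax_form B (l n) x h - T m x ** lax_form B (l m) x h
        = (T n x - T m x) ** lax_form B (l n) x h + T m x ** ((mat (l n) - mat (l m)) ** dg h)"
      by (simp add: lax_form_eq mat_mult_eq_cscale matrix_ring_simps)
    moreover have "norm (T m x ** ((mat (l n) - mat (l m)) ** dg h))
      \<le> (2 * M0) * (norm (mat (l n) - mat (l m) :: complex^'n^'n) * (norm h * d) * K) * K"
      using K(1) bound[OF x, of m] d M0'
      by (intro order_trans[OF K(2)] mult_mono mult_right_mono order_refl mult_left_mono) auto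
    ultimately show "norm (T n x ** lax_form B (l n) x h - T m x ** lax_form B (l m) x h)
        \<le> (C * norm (T n x - T m x) + D n m) * norm h"
      using mult_lax[OF x, of "T n x - T m x" n h]
      by (auto simp: D_def algebra_simps intro: norm_triangle_le)
  next
    show "0 \<le> D n m"
      using K(1) d M0' by (simp add: D_def)
  qed
  define D0 where "D0 = (\<lambda>n. 2 * M0 * (norm (mat (l n) - mat l0 :: complex^'n^'n) * d * K) * K)"
  have diff0: "norm (T n x - T0 x) \<le> 2 * (norm (T n x0 - T0 x0) + D0 n * r)"
    if x: "x \<in> cball x0 r" for n x
  proof (rule LIMSEQ_le)
    show "(\<lambda>m. norm (T n x - T m x)) \<longlonglongrightarrow> norm (T n x - T0 x)"
      by (intro tendsto_intros lim inV x)
    show "(\<lambda>m. 2 * (norm (T n x0 - T m x0) + D n m * r)) \<longlonglongrightarrow> 2 * (norm (T n x0 - T0 x0) + D0 n * r)"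
      unfolding D_def D0_def by (intro tendsto_intros lim V matl)
    show "\<exists>N. \<forall>m\<ge>N. norm (T n x - T m x) \<le> 2 * (norm (T n x0 - T m x0) + D n m * r)"
      using diff[OF x] by blast
  qed
  have "(\<lambda>n. 2 * (norm (T n x0 - T0 x0) + D0 n * r))
      \<longlonglongrightarrow> 2 * (norm (T0 x0 - T0 x0) + (2 * M0 * (norm (mat l0 - mat l0 :: complex^'n^'n) * d * K) * K) * r)"
    unfolding D0_def by (intro tendsto_intros lim V matl)
  then have to0: "(\<lambda>n. 2 * (norm (T n x0 - T0 x0) + D0 n * r)) \<longlonglongrightarrow> 0"
    by simp
  show ?thesis
  proof (intro exI conjI ballI allI impI)
    show "r > 0"
      by (rule r)
    show "cball x0 r \<subseteq> V"
      using inV by blast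
    show "norm (lax_form B (l n) x h) \<le> C0 * norm h" if "x \<in> cball x0 r" for x h n
      using lax that sub by blast
    show "norm (T0 x) \<le> 2 * M0" if "x \<in> cball x0 r" for x
      using bound0 that .
    show "\<forall>\<^sub>F n in sequentially. \<forall>x\<in>cball x0 r. norm (T n x - T0 x) \<le> e" if "e > 0" for e
      using order_tendstoD(2)[OF to0 that]
    proof eventually_elim
      case (elim n)
      show ?case
        using order_trans[OF diff0 less_imp_le[OF elim]] by blast
    qed
  qed
qed

text \<open>The derivatives \<open>T n x ** lax_form B (l n) x h\<close> converge uniformly on a
  small ball, so the limit can be taken under the derivative. This yields the system of a dressed
  frame at its pole.\<close>

lemma lax_solutions_limit:
  fixes T :: "nat \<Rightarrow> real^'n::finite \<Rightarrow> complex^'n^'n" and B :: "real^'n \<Rightarrow> complex^'n^'n"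
  assumes V: "open V" "x0 \<in> V" and B: "continuous_on V B" and l: "l \<longlonglongrightarrow> l0"
    and der: "\<And>n x. x \<in> V \<Longrightarrow> (T n has_derivative (\<lambda>h. T n x ** lax_form B (l n) x h)) (at x)"
    and lim: "\<And>x. x \<in> V \<Longrightarrow> (\<lambda>n. T n x) \<longlonglongrightarrow> T0 x"
  shows "(T0 has_derivative (\<lambda>h. T0 x0 ** lax_form B l0 x0 h)) (at x0)"
proof -
  have "\<exists>K>0. \<forall>(X :: complex^'n^'n) (Y :: complex^'n^'n). norm (X ** Y) \<le> norm X * norm Y * K"
    by (rule mm.pos_bounded)
  then obtain K where K: "K > 0" "\<And>(X :: complex^'n^'n) (Y :: complex^'n^'n). norm (X ** Y) \<le> norm X * norm Y * K"
    by auto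
  have "\<exists>d>0. \<forall>h :: real^'n. norm (dg h) \<le> norm h * d"
    by (rule bounded_linear.pos_bounded[OF bounded_linear_dg])
  then obtain d where d: "d > 0" "\<And>h :: real^'n. norm (dg h) \<le> norm h * d"
    by auto
  have "(\<lambda>n. mat (l n) :: complex^'n^'n) \<longlonglongrightarrow> mat l0"
    by (rule tendsto_mat[OF l])
  from tendsto_norm[OF LIM_zero[OF this]]
  have matl: "(\<lambda>n. norm (mat (l n) - mat l0 :: complex^'n^'n)) \<longlonglongrightarrow> 0"
    by simp
  obtain r C M where r: "r > 0" "cball x0 r \<subseteq> V"
    and C': "\<forall>x\<in>cball x0 r. \<forall>h n. norm (lax_form B (l n) x h) \<le> C * norm h"
    and M': "\<forall>x\<in>cball x0 r. norm (T0 x) \<le> M"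
    and conv: "\<forall>e>0. \<forall>\<^sub>F n in sequentially. \<forall>x\<in>cball x0 r. norm (T n x - T0 x) \<le> e"
    using lax_solutions_uniform_limit[OF V B l der lim] by blast
  note C = C'[rule_format] and M = M'[rule_format]
  have inV: "x \<in> V" if "x \<in> cball x0 r" for x
    using that r by blast
  have M0: "0 \<le> M"
    using order_trans[OF norm_ge_zero M[of x0]] r by simp
  have "\<exists>g. \<forall>x\<in>cball x0 r. (\<lambda>n. T n x) \<longlonglongrightarrow> g x \<and>
      (g has_derivative (\<lambda>h. T0 x ** lax_form B l0 x h)) (at x within cball x0 r)"
  proof (rule has_derivative_sequence[OF convex_cball, where f = T
        and f' = "\<lambda>n x h. T n x ** lax_form B (l n) x h"])
    show "(T n has_derivative (\<lambda>h. T n x ** lax_form B (l n) x h)) (at x within cball x0 r)"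
      if "x \<in> cball x0 r" for n x
      by (rule has_derivative_at_withinI[OF der[OF inV[OF that]]])
    show "\<forall>\<^sub>F n in sequentially. \<forall>x\<in>cball x0 r. \<forall>h.
        norm (T n x ** lax_form B (l n) x h - T0 x ** lax_form B l0 x h) \<le> e * norm h"
      if e: "e > 0" for e
    proof -
      \<comment> \<open>\<open>C\<close> was obtained without a sign. \<open>c\<close> and
        \<open>m\<close> are positive majorants of \<open>C\<close> and \<open>M\<close>, chosen so
        that one can divide by them; \<open>e1\<close> and \<open>e2\<close> then make each of the
        two error terms at most half of \<open>e\<close>.\<close>
      define c where "c = \<bar>C\<bar> + 1"
      have c: "c > 0" "C \<le> c"
        by (simp_all add: c_def)
      define e1 where "e1 = e / (2 * c * K)"
      define m where "m = M + 1"
      have m: "m > 0" "M \<le> m"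
        using M0 by (simp_all add: m_def)
      define e2 where "e2 = e / (2 * m * d * K * K)"
      have e12: "e1 > 0" "e2 > 0"
        using e K d m c by (simp_all add: e1_def e2_def)
      show ?thesis
        using conv[rule_format, OF e12(1)] order_tendstoD(2)[OF matl e12(2)]
      proof eventually_elim
        case (elim n)
        show ?case
        proof (intro ballI allI)
          fix x h assume x: "x \<in> cball x0 r"
          have "norm ((T n x - T0 x) ** lax_form B (l n) x h) \<le> e1 * (c * norm h) * K"
          proof (intro order_trans[OF K(2)] mult_right_mono mult_mono)
            have "C * norm h \<le> c * norm h"
              by (intro mult_right_mono c) auto
            then show "norm (lax_form B (l n) x h) \<le> c * norm h"
              using C[OF x, of n h] by linarith
          qed (use elim x K e12 c in auto)
          also have "\<dots> = e / 2 * norm h"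
            using K c by (simp add: e1_def field_simps)
          finally have 1: "norm ((T n x - T0 x) ** lax_form B (l n) x h) \<le> e / 2 * norm h" .
          have "norm (T0 x ** ((mat (l n) - mat l0) ** dg h)) \<le> m * (e2 * (norm h * d) * K) * K"
          proof (intro order_trans[OF K(2)] mult_mono mult_right_mono)
            show "norm (T0 x) \<le> m"
              using M[OF x] m by simp
            show "norm (mat (l n) - mat l0 :: complex^'n^'n) \<le> e2"
              using elim(2) by simp
          qed (use d K e12 m in auto)
          also have "\<dots> = e / 2 * norm h"
            using K d m by (simp add: e2_def field_simps)
          finally have 2: "norm (T0 x ** ((mat (l n) - mat l0) ** dg h)) \<le> e / 2 * norm h" .
          have "T n x ** lax_form B (l n) x h - T0 x ** lax_form B l0 x h
              = (T n x - T0 x) ** lax_form B (l n) x h + T0 x ** ((mat (l n) - mat l0) ** dg h)"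
            by (simp add: lax_form_eq mat_mult_eq_cscale matrix_ring_simps)
          then show "norm (T n x ** lax_form B (l n) x h - T0 x ** lax_form B l0 x h) \<le> e * norm h"
            using 1 2 by (auto intro: norm_triangle_le)
        qed
      qed
    qed
    show "x0 \<in> cball x0 r"
      using r by simp
    show "(\<lambda>n. T n x0) \<longlonglongrightarrow> T0 x0"
      by (rule lim[OF V(2)])
  qed
  then obtain g where g: "\<And>x. x \<in> cball x0 r \<Longrightarrow> (\<lambda>n. T n x) \<longlonglongrightarrow> g x"
    and g': "\<And>x. x \<in> cball x0 r \<Longrightarrow>
      (g has_derivative (\<lambda>h. T0 x ** lax_form B l0 x h)) (at x within cball x0 r)"
    by blast
  \<comment> \<open>The sequence theorem only yields some limit function \<open>g\<close>,
    differentiable within the closed ball. Uniqueness of limits identifies it, and at the centre the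
    restriction to the ball disappears.\<close>
  have eq: "g x = T0 x" if "x \<in> ball x0 r" for x
  proof -
    have x: "x \<in> cball x0 r"
      using that by simp
    show ?thesis
      by (rule LIMSEQ_unique[OF g[OF x] lim[OF inV[OF x]]])
  qed
  have at_x0: "at x0 within cball x0 r = at x0"
    by (rule at_within_interior) (simp add: r(1))
  have "(g has_derivative (\<lambda>h. T0 x0 ** lax_form B l0 x0 h)) (at x0)"
    using g'[of x0] unfolding at_x0 by (simp add: r(1) less_imp_le)
  then show ?thesis
    by (rule has_derivative_transform_within_open[OF _ open_ball iffD2[OF centre_in_ball r(1)] eq])
qed

lemma lax_solution_has_derivative:
  assumes "lax_solution V B F" "x \<in> V"
  shows "((\<lambda>y. F y l) has_derivative (\<lambda>h. F x l ** lax_form B l x h)) (at x)"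
  using assms by (simp add: lax_solution_def)

lemma lax_solution_invertible:
  assumes "lax_solution V B F" "x \<in> V"
  shows "invertible (F x l)"
  using assms by (simp add: lax_solution_def entire_GL_def)

lemma lax_solution_entire:
  assumes "lax_solution V B F" "x \<in> V"
  shows "entire_matrix (F x)"
  using assms by (simp add: lax_solution_def entire_GL_iff)

lemma lax_solution_inv_has_derivative:
  assumes V: "open V" "x \<in> V" and F: "lax_solution V B F"
  shows "((\<lambda>y. matrix_inv (F y c)) has_derivative
      (\<lambda>h. - (lax_form B c x h ** matrix_inv (F x c)))) (at x)"
proof -
  have "matrix_inv (F x c) ** (F x c ** lax_form B c x h) ** matrix_inv (F x c)
      = lax_form B c x h ** matrix_inv (F x c)" for h
    by (simp add: matrix_inv_mult_cancel lax_solution_invertible[OF F V(2)])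
  with has_derivative_matrix_inv[OF V lax_solution_invertible[OF F] lax_solution_has_derivative[OF F V(2)], of c]
  show ?thesis by simp
qed

lemma LIMSEQ_add_inverse_Suc: "(\<lambda>n. c + 1 / of_nat (Suc n)) \<longlonglongrightarrow> (c :: complex)"
  using tendsto_add[OF tendsto_const LIMSEQ_Suc[OF lim_1_over_n], of c] by simp

text \<open>E_1 is the limit of the difference quotients \<open>Q n\<close> at
  \<open>l n = c + 1/(n+1)\<close>. Each of them is built from values of the frame at two fixed
  parameters, hence differentiable in x, with derivative F(l_n) a F(c)^-1 free of B. These
  derivatives converge uniformly near x0, which justifies exchanging d/dx and d/dlambda.\<close>

lemma log_deriv_has_derivative:
  fixes F :: "real^'n::finite \<Rightarrow> complex \<Rightarrow> complex^'n^'n"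
  assumes V: "open V" "x0 \<in> V" and B: "continuous_on V B" and F: "lax_solution V B F"
  shows "((\<lambda>x. log_deriv c (F x)) has_derivative
    (\<lambda>h. F x0 c ** dg h ** matrix_inv (F x0 c))) (at x0)"
proof -
  define l where "l = (\<lambda>n. c + 1 / of_nat (Suc n) :: complex)"
  have l: "l \<longlonglongrightarrow> c"
    unfolding l_def by (rule LIMSEQ_add_inverse_Suc)
  have l_ne: "l n \<noteq> c" for n
    by (simp add: l_def del: of_nat_Suc)
  have l_at: "filterlim l (at c) sequentially"
    by (rule filterlim_atI[OF l]) (simp add: l_ne)
  have "\<exists>K>0. \<forall>(X :: complex^'n^'n) (Y :: complex^'n^'n). norm (X ** Y) \<le> norm X * norm Y * K"
    by (rule mm.pos_bounded)
  then obtain K where K: "K > 0" "\<And>(X :: complex^'n^'n) (Y :: complex^'n^'n). norm (X ** Y) \<le> norm X * norm Y * K"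
    by auto
  have "\<exists>d>0. \<forall>h :: real^'n. norm (dg h) \<le> norm h * d"
    by (rule bounded_linear.pos_bounded[OF bounded_linear_dg])
  then obtain d where d: "d > 0" "\<And>h :: real^'n. norm (dg h) \<le> norm h * d"
    by auto
  have entire: "entire_matrix (F x)" if "x \<in> V" for x
    using F that by (rule lax_solution_entire)
  have inv: "invertible (F x c)" if "x \<in> V" for x
    using F that by (rule lax_solution_invertible)
  have der: "((\<lambda>y. F y m) has_derivative (\<lambda>h. F x m ** lax_form B m x h)) (at x)"
    if "x \<in> V" for x m
    using F that by (rule lax_solution_has_derivative)
  have lim: "(\<lambda>n. F x (l n)) \<longlonglongrightarrow> F x c" if "x \<in> V" for x
    by (rule filterlim_compose[OF entire_matrix_tendsto[OF entire[OF that]] l_at])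
  note der_inv = lax_solution_inv_has_derivative[OF V(1) _ F, of _ c]
  have "\<exists>r C M. r > 0 \<and> cball x0 r \<subseteq> V \<and>
    (\<forall>x\<in>cball x0 r. \<forall>h n. norm (lax_form B (l n) x h) \<le> C * norm h) \<and>
    (\<forall>x\<in>cball x0 r. norm (F x c) \<le> M) \<and>
    (\<forall>e>0. \<forall>\<^sub>F n in sequentially. \<forall>x\<in>cball x0 r. norm (F x (l n) - F x c) \<le> e)"
    by (rule lax_solutions_uniform_limit[OF V B l, where T = "\<lambda>n x. F x (l n)"])
      (simp_all add: der lim)
  then obtain r where r: "r > 0" "cball x0 r \<subseteq> V"
    and conv: "\<forall>e>0. \<forall>\<^sub>F n in sequentially. \<forall>x\<in>cball x0 r. norm (F x (l n) - F x c) \<le> e"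
    by blast
  have inV: "x \<in> V" if "x \<in> cball x0 r" for x
    using that r by blast
  have "continuous_on (cball x0 r) (\<lambda>x. matrix_inv (F x c))"
    by (intro continuous_at_imp_continuous_on ballI has_derivative_continuous[OF der_inv[OF inV]])
  then have "bounded ((\<lambda>x. matrix_inv (F x c)) ` cball x0 r)"
    by (intro compact_imp_bounded compact_continuous_image compact_cball)
  then obtain m where m: "m > 0" "\<And>x. x \<in> cball x0 r \<Longrightarrow> norm (matrix_inv (F x c)) \<le> m"
    unfolding bounded_pos by blast
  define Q where "Q = (\<lambda>n x. cscale (of_nat (Suc n)) (F x (l n) ** matrix_inv (F x c) - mat 1))"
  have Q: "(Q n has_derivative (\<lambda>h. F x (l n) ** dg h ** matrix_inv (F x c))) (at x)"
    if x: "x \<in> V" for n x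
  proof -
    have "(Q n has_derivative (\<lambda>h. cscale (of_nat (Suc n))
        (F x (l n) ** - (lax_form B c x h ** matrix_inv (F x c))
         + F x (l n) ** lax_form B (l n) x h ** matrix_inv (F x c) - 0))) (at x)"
      unfolding Q_def
      by (intro bounded_linear.has_derivative[OF bounded_linear_cscale] has_derivative_diff
          has_derivative_const mm.FDERIV der der_inv x)
    moreover have "cscale (of_nat (Suc n))
        (F x (l n) ** - (lax_form B c x h ** matrix_inv (F x c))
         + F x (l n) ** lax_form B (l n) x h ** matrix_inv (F x c) - 0)
        = F x (l n) ** dg h ** matrix_inv (F x c)" for h
    proof -
      \<comment> \<open>The bracket parts cancel and leave the factor \<open>l n - c\<close>, which
        the prefactor n+1 of the difference quotient turns into 1.\<close>
      have "F x (l n) ** - (lax_form B c x h ** matrix_inv (F x c))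
         + F x (l n) ** lax_form B (l n) x h ** matrix_inv (F x c) - 0
        = cscale (l n - c) (F x (l n) ** dg h ** matrix_inv (F x c))"
        by (simp add: lax_form_eq matrix_ring_simps cscale_diff_left)
      moreover have "of_nat (Suc n) * (l n - c) = 1"
        by (simp add: l_def del: of_nat_Suc)
      ultimately show ?thesis
        by (simp del: of_nat_Suc)
    qed
    ultimately show ?thesis
      by (simp del: of_nat_Suc)
  qed
  have Q_lim: "(\<lambda>n. Q n x) \<longlonglongrightarrow> log_deriv c (F x)" if x: "x \<in> V" for x
  proof -
    have "(\<lambda>n. cscale (of_nat (Suc n)) (F x (l n) - F x c)) \<longlonglongrightarrow> (\<chi> i j. deriv (\<lambda>l. F x l $ i $ j) c)"
    proof (intro vec_tendstoI)
      fix i j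
      have "(\<lambda>l. F x l $ i $ j) holomorphic_on UNIV"
        using entire[OF x] by (simp add: entire_matrix_def)
      then have "((\<lambda>l. F x l $ i $ j) has_field_derivative deriv (\<lambda>l. F x l $ i $ j) c) (at c)"
        by (intro holomorphic_derivI[of _ UNIV]) auto
      then have "((\<lambda>l. (F x l $ i $ j - F x c $ i $ j) / (l - c)) \<longlongrightarrow> deriv (\<lambda>l. F x l $ i $ j) c) (at c)"
        by (simp add: has_field_derivative_iff)
      then have "(\<lambda>n. (F x (l n) $ i $ j - F x c $ i $ j) / (l n - c)) \<longlonglongrightarrow> deriv (\<lambda>l. F x l $ i $ j) c"
        by (rule filterlim_compose[OF _ l_at])
      moreover have "(F x (l n) $ i $ j - F x c $ i $ j) / (l n - c)
          = cscale (of_nat (Suc n)) (F x (l n) - F x c) $ i $ j" for n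
        by (simp add: l_def mult.commute del: of_nat_Suc)
      ultimately show "(\<lambda>n. cscale (of_nat (Suc n)) (F x (l n) - F x c) $ i $ j)
          \<longlonglongrightarrow> (\<chi> i j. deriv (\<lambda>l. F x l $ i $ j) c) $ i $ j"
        by simp
    qed
    then have "(\<lambda>n. cscale (of_nat (Suc n)) (F x (l n) - F x c) ** matrix_inv (F x c)) \<longlonglongrightarrow> log_deriv c (F x)"
      unfolding log_deriv_def by (intro mm.tendsto tendsto_const)
    then show ?thesis
      by (simp add: Q_def matrix_ring_simps matrix_inv_works[OF inv[OF x]] del: of_nat_Suc)
  qed
  have "\<exists>g. \<forall>x\<in>cball x0 r. (\<lambda>n. Q n x) \<longlonglongrightarrow> g x \<and>
      (g has_derivative (\<lambda>h. F x c ** dg h ** matrix_inv (F x c))) (at x within cball x0 r)"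
  proof (rule has_derivative_sequence[OF convex_cball, where f = Q
        and f' = "\<lambda>n x h. F x (l n) ** dg h ** matrix_inv (F x c)"])
    show "(Q n has_derivative (\<lambda>h. F x (l n) ** dg h ** matrix_inv (F x c))) (at x within cball x0 r)"
      if "x \<in> cball x0 r" for n x
      by (rule has_derivative_at_withinI[OF Q[OF inV[OF that]]])
    show "\<forall>\<^sub>F n in sequentially. \<forall>x\<in>cball x0 r. \<forall>h.
        norm (F x (l n) ** dg h ** matrix_inv (F x c) - F x c ** dg h ** matrix_inv (F x c)) \<le> e * norm h"
      if e: "e > 0" for e
    proof -
      define e1 where "e1 = e / (d * K * m * K)"
      have e1: "e1 > 0"
        using e K d m by (simp add: e1_def)
      show ?thesis
        using conv[rule_format, OF e1]
      proof eventually_elim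
        case (elim n)
        show ?case
        proof (intro ballI allI)
          fix x h assume x: "x \<in> cball x0 r"
          have "norm (((F x (l n) - F x c) ** dg h) ** matrix_inv (F x c)) \<le> (e1 * (norm h * d) * K) * m * K"
            by (intro order_trans[OF K(2)] mult_mono mult_right_mono)
              (use elim x m K e1 d in auto)
          also have "\<dots> = e * norm h"
            using K d m by (simp add: e1_def field_simps)
          finally show "norm (F x (l n) ** dg h ** matrix_inv (F x c)
              - F x c ** dg h ** matrix_inv (F x c)) \<le> e * norm h"
            by (simp add: matrix_ring_simps)
        qed
      qed
    qed
    show "x0 \<in> cball x0 r"
      using r by simp
    show "(\<lambda>n. Q n x0) \<longlonglongrightarrow> log_deriv c (F x0)"
      by (rule Q_lim[OF V(2)])
  qed
  then obtain g where g: "\<And>x. x \<in> cball x0 r \<Longrightarrow> (\<lambda>n. Q n x) \<longlonglongrightarrow> g x"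
    and g': "\<And>x. x \<in> cball x0 r \<Longrightarrow>
      (g has_derivative (\<lambda>h. F x c ** dg h ** matrix_inv (F x c))) (at x within cball x0 r)"
    by blast
  have eq: "g x = log_deriv c (F x)" if "x \<in> ball x0 r" for x
  proof -
    have x: "x \<in> cball x0 r"
      using that by simp
    show ?thesis
      by (rule LIMSEQ_unique[OF g[OF x] Q_lim[OF inV[OF x]]])
  qed
  have at_x0: "at x0 within cball x0 r = at x0"
    by (rule at_within_interior) (simp add: r(1))
  have "(g has_derivative (\<lambda>h. F x0 c ** dg h ** matrix_inv (F x0 c))) (at x0)"
    using g'[of x0] unfolding at_x0 by (simp add: r(1) less_imp_le)
  then show ?thesis
    by (rule has_derivative_transform_within_open[OF _ open_ball iffD2[OF centre_in_ball r(1)] eq])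
qed

subsection \<open>Dressing by a simple element\<close>

lemma simple_elem_eq: "simple_elem c P l = mat 1 + cscale (1 / (l - c)) P"
  by (simp add: simple_elem_def mat_mult_eq_cscale)

lemma simple_elem_inverse:
  fixes P :: "complex^'n^'n::finite"
  assumes "P ** P = 0"
  shows "simple_elem c P l ** simple_elem c (- P) l = mat 1"
    "invertible (simple_elem c P l)" "matrix_inv (simple_elem c P l) = simple_elem c (- P) l"
proof -
  show 1: "simple_elem c P l ** simple_elem c (- P) l = mat 1"
    by (simp add: simple_elem_eq matrix_ring_simps assms)
  show "invertible (simple_elem c P l)" "matrix_inv (simple_elem c P l) = simple_elem c (- P) l"
    using matrix_inv_unique[OF 1] by simp_all
qed

text \<open>Continuity at c: identities computed with 1/(l - c) extend to the pole.\<close>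

lemma entire_matrix_eq_at:
  assumes "entire_matrix f" "entire_matrix g" "\<And>l. l \<noteq> c \<Longrightarrow> f l = g l"
  shows "f c = g c"
proof -
  have "(f \<longlongrightarrow> g c) (at c)"
    using entire_matrix_tendsto[OF assms(2)]
    by (rule Lim_transform_eventually) (simp add: eventually_at_filter assms(3))
  with entire_matrix_tendsto[OF assms(1)] show ?thesis
    by (rule tendsto_unique[OF at_neq_bot])
qed

text \<open>The divided difference of F at c, completed by the derivative. It is entire again and
  can be iterated, so Taylor expansion at c becomes exact algebra with an entire remainder.\<close>

definition divdiff :: "complex \<Rightarrow> (complex \<Rightarrow> complex^'n^'n) \<Rightarrow> complex \<Rightarrow> complex^'n^'n::finite" where
  "divdiff c F l = (\<chi> i j. if l = c then deriv (\<lambda>z. F z $ i $ j) c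
                          else (F l $ i $ j - F c $ i $ j) / (l - c))"

lemma entire_divdiff: "entire_matrix F \<Longrightarrow> entire_matrix (divdiff c F)"
  unfolding entire_matrix_def divdiff_def vec_lambda_beta
  by (intro allI pole_lemma_open[OF _ open_UNIV]) blast

lemma divdiff_expand: "F l = F c + cscale (l - c) (divdiff c F l)"
  by (cases "l = c") (simp_all add: vec_eq_iff divdiff_def)

lemma divdiff_cancel: "l \<noteq> c \<Longrightarrow> divdiff c F l = cscale (1 / (l - c)) (F l - F c)"
  by (simp add: vec_eq_iff divdiff_def)

lemma log_deriv_eq: "log_deriv c F = divdiff c F c ** matrix_inv (F c)"
  by (simp add: log_deriv_def divdiff_def)

text \<open>Off c this comes from F(l)^-1 - F(c)^-1 = - F(c)^-1 (F(l) - F(c)) F(l)^-1; both sides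
  are entire after division by l - c, so it persists at c.\<close>

lemma divdiff_matrix_inv:
  fixes F :: "complex \<Rightarrow> complex^'n^'n::finite"
  assumes F: "entire_matrix F" and inv: "\<And>l. invertible (F l)"
  shows "divdiff c (\<lambda>l. matrix_inv (F l)) c
    = - (matrix_inv (F c) ** divdiff c F c ** matrix_inv (F c))"
proof -
  let ?g = "\<lambda>l. 0 - matrix_inv (F c) ** divdiff c F l ** matrix_inv (F l)"
  have "divdiff c (\<lambda>l. matrix_inv (F l)) c = ?g c"
  proof (rule entire_matrix_eq_at[where f = "divdiff c (\<lambda>l. matrix_inv (F l))" and g = ?g])
    show "entire_matrix (divdiff c (\<lambda>l. matrix_inv (F l)))"
      by (intro entire_divdiff entire_matrix_inv F inv)
    show "entire_matrix ?g"
      by (intro entire_matrix_diff entire_matrix_mult entire_matrix_const entire_divdiff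
          entire_matrix_inv F inv)
    show "divdiff c (\<lambda>l. matrix_inv (F l)) l = ?g l" if "l \<noteq> c" for l
      by (simp add: divdiff_cancel[OF that] matrix_ring_simps matrix_inv_works inv matrix_inv_mult_cancel)
  qed
  then show ?thesis by simp
qed

text \<open>The function \<open>(1 + A / \<mu>) F (1 - B / \<mu>)\<close>, \<open>\<mu> = l - c\<close>, freed of its polar part.\<close>

definition regularized ::
  "complex \<Rightarrow> complex^'n^'n \<Rightarrow> complex^'n^'n \<Rightarrow> (complex \<Rightarrow> complex^'n^'n) \<Rightarrow>
   complex \<Rightarrow> complex^'n^'n::finite" where
  "regularized c A B F l =
     F l + A ** divdiff c F l - divdiff c F l ** B - A ** divdiff c (divdiff c F) l ** B"

lemma entire_regularized: "entire_matrix F \<Longrightarrow> entire_matrix (regularized c A B F)"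
  unfolding regularized_def
  by (intro entire_matrix_diff entire_matrix_add entire_matrix_mult entire_matrix_const entire_divdiff)

text \<open>In powers of l - c, the hypotheses named 2 and 1 are the vanishing of the coefficients
  of order -2 and -1 of the product. Expanding F to second order leaves exactly
  \<open>regularized\<close>.\<close>

lemma regularized_eq:
  fixes A B :: "complex^'n^'n::finite"
  assumes 2: "A ** F c ** B = 0"
    and 1: "A ** F c - F c ** B = A ** divdiff c F c ** B"
    and l: "l \<noteq> c"
  shows "regularized c A B F l = simple_elem c A l ** F l ** simple_elem c (- B) l"
proof -
  define m where "m = l - c"
  have m: "m \<noteq> 0"
    using l by (simp add: m_def)
  let ?D1 = "divdiff c F l" and ?D2 = "divdiff c (divdiff c F) l"
  have F: "F l = F c + cscale m ?D1" and D: "?D1 = divdiff c F c + cscale m ?D2"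
    using divdiff_expand[of F l c] divdiff_expand[of "divdiff c F" l c] by (simp_all add: m_def)
  have AFB: "A ** F l ** B = cscale m (A ** divdiff c F c ** B) + cscale (m * m) (A ** ?D2 ** B)"
  proof -
    have "A ** F l ** B = A ** F c ** B + cscale m (A ** ?D1 ** B)"
      by (subst F) (simp add: matrix_ring_simps)
    also have "A ** ?D1 ** B = A ** divdiff c F c ** B + cscale m (A ** ?D2 ** B)"
      by (subst D) (simp add: matrix_ring_simps)
    finally show ?thesis
      by (simp add: 2 cscale_distrib)
  qed
  have AF: "A ** F l - F l ** B = A ** divdiff c F c ** B + cscale m (A ** ?D1 - ?D1 ** B)"
    unfolding 1[symmetric] by (subst (1 2) F) (simp add: matrix_ring_simps)
  have "simple_elem c A l ** F l ** simple_elem c (- B) l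
      = F l + cscale (1 / m) (A ** F l - F l ** B) - cscale (1 / (m * m)) (A ** F l ** B)"
    by (simp add: simple_elem_eq m_def[symmetric] matrix_ring_simps)
  also have "\<dots> = regularized c A B F l"
    using m by (simp add: AF AFB regularized_def cscale_distrib)
  finally show ?thesis by simp
qed

locale nilpotent_dressing =
  fixes c :: complex and P :: "complex^'n^'n::finite" and F :: "complex \<Rightarrow> complex^'n^'n"
  assumes F: "entire_GL F" and P: "P ** P = 0"
    and inv_PL: "invertible (mat 1 + P ** log_deriv c F)"
begin

lemma entire_F: "entire_matrix F" and inv_F: "invertible (F l)"
  using F by (simp_all add: entire_GL_iff)

definition Q where "Q = matrix_inv (mat 1 + P ** log_deriv c F) ** P"

text \<open>Because P^2 = 0, multiplying 1 + P L by P from the left gives P, so P also absorbs the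
  inverse: P R = P. This kills P Q and Q Q; the two identities with L restate that R is a right and
  a left inverse.\<close>

lemma Q_eqs:
  "P ** Q = 0" "Q ** P = 0" "Q ** Q = 0"
  "P ** log_deriv c F ** Q = P - Q" "Q ** log_deriv c F ** P = P - Q"
proof -
  let ?L = "log_deriv c F" and ?R = "matrix_inv (mat 1 + P ** log_deriv c F)"
  have "P = P ** (mat 1 + P ** ?L) ** ?R"
    by (simp add: matrix_mul_assoc[symmetric] matrix_inv_works[OF inv_PL])
  also have "P ** (mat 1 + P ** ?L) = P"
    by (simp add: matrix_ring_simps) (simp add: matrix_mul_assoc P)
  finally have PR: "P ** ?R = P" by simp
  show PQ: "P ** Q = 0"
    by (simp add: Q_def matrix_mul_assoc PR P)
  show "Q ** P = 0"
    by (simp add: Q_def matrix_mul_assoc[symmetric] P)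
  show "Q ** Q = 0"
    by (subst Q_def) (simp add: matrix_mul_assoc[symmetric] PQ)
  have "(mat 1 + P ** ?L) ** Q = P"
    by (simp add: Q_def matrix_mul_assoc matrix_inv_works[OF inv_PL])
  then show "P ** ?L ** Q = P - Q"
    by (simp add: mm.add_left algebra_simps)
  have "Q + Q ** ?L ** P = ?R ** (mat 1 + P ** ?L) ** P"
    by (simp add: Q_def matrix_ring_simps)
  then have "Q + Q ** ?L ** P = P"
    by (simp add: matrix_inv_works[OF inv_PL])
  then show "Q ** ?L ** P = P - Q"
    by (simp add: algebra_simps)
qed

lemma dressed_nilp_eq: "dressed_nilp c P F = matrix_inv (F c) ** Q ** F c"
  by (simp add: dressed_nilp_def Q_def matrix_mul_assoc)

lemma dressed_nilp_square: "dressed_nilp c P F ** dressed_nilp c P F = 0"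
proof -
  have "dressed_nilp c P F ** dressed_nilp c P F = matrix_inv (F c) ** (Q ** Q) ** F c"
    by (simp add: dressed_nilp_eq matrix_mul_assoc[symmetric] matrix_inv_mult_cancel[OF inv_F])
  then show ?thesis
    by (simp add: Q_eqs)
qed

text \<open>The entire continuation of \<open>dressed_frame\<close>, whose own value at c is
  spurious, since both simple elements degenerate to the identity there.\<close>

definition ext where "ext = regularized c P (dressed_nilp c P F) F"

text \<open>Moving F(c) past the dressed nilpotent turns it into Q. The double pole then cancels by
  P Q = 0 and the simple pole by P L Q = P - Q.\<close>

lemma ext_eq_simple:
  assumes "l \<noteq> c"
  shows "ext l = simple_elem c P l ** F l ** simple_elem c (- dressed_nilp c P F) l"
  unfolding ext_def
proof (rule regularized_eq[OF _ _ assms])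
  have *: "F c ** dressed_nilp c P F = Q ** F c"
    by (simp add: dressed_nilp_eq matrix_mul_assoc[symmetric] matrix_inv_mult_cancel[OF inv_F])
  show "P ** F c ** dressed_nilp c P F = 0"
    by (simp add: matrix_mul_assoc[symmetric] *) (simp add: matrix_mul_assoc Q_eqs)
  have "P ** divdiff c F c ** dressed_nilp c P F = P ** log_deriv c F ** Q ** F c"
    by (simp add: log_deriv_eq dressed_nilp_eq matrix_mul_assoc)
  then show "P ** F c - F c ** dressed_nilp c P F = P ** divdiff c F c ** dressed_nilp c P F"
    by (simp add: * Q_eqs mm.diff_left)
qed

lemma ext_eq:
  assumes "l \<noteq> c"
  shows "ext l = dressed_frame c P F l"
  unfolding dressed_frame_def simple_elem_inverse(3)[OF dressed_nilp_square] by (rule ext_eq_simple[OF assms])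

text \<open>The inverse is built in the same way from the inverse of F with the two nilpotents
  exchanged; its poles cancel by Q P = 0 and Q L P = P - Q. The product is 1 off c, hence also at c
  by continuity.\<close>

lemma entire_GL_ext: "entire_GL ext"
  unfolding entire_GL_iff
proof (intro conjI allI)
  show entire: "entire_matrix ext"
    unfolding ext_def by (rule entire_regularized[OF entire_F])
  let ?Fi = "\<lambda>l. matrix_inv (F l)" and ?N = "dressed_nilp c P F"
  define G where "G = regularized c ?N P ?Fi"
  have entire_G: "entire_matrix G"
    unfolding G_def by (intro entire_regularized entire_matrix_inv entire_F inv_F)
  have NFi: "?N ** ?Fi c = ?Fi c ** Q"
    by (simp add: dressed_nilp_eq matrix_mul_assoc[symmetric] matrix_inv_works[OF inv_F])
  have G: "G l = simple_elem c ?N l ** ?Fi l ** simple_elem c (- P) l" if "l \<noteq> c" for l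
    unfolding G_def
  proof (rule regularized_eq[OF _ _ that])
    show "?N ** ?Fi c ** P = 0"
      by (simp add: NFi) (simp add: matrix_mul_assoc[symmetric] Q_eqs)
    have "?N ** divdiff c ?Fi c ** P = - (?Fi c ** (Q ** log_deriv c F ** P))"
      by (simp add: divdiff_matrix_inv[OF entire_F inv_F] log_deriv_eq matrix_mul_assoc NFi mm.minus_left mm.minus_right)
    then show "?N ** ?Fi c - ?Fi c ** P = ?N ** divdiff c ?Fi c ** P"
      by (simp add: Q_eqs NFi mm.diff_right)
  qed
  have one: "ext l ** G l = mat 1" if l: "l \<noteq> c" for l
  proof -
    have "simple_elem c (- ?N) l ** simple_elem c ?N l = mat 1"
      using matrix_inv_unique(4)[OF simple_elem_inverse(1)[OF dressed_nilp_square]] .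
    then have "ext l ** G l = simple_elem c P l ** (F l ** ?Fi l) ** simple_elem c (- P) l"
      unfolding ext_eq_simple[OF l] G[OF l] by (metis matrix_mul_assoc matrix_mul_rid)
    then show ?thesis
      by (simp add: matrix_inv_works[OF inv_F] simple_elem_inverse(1)[OF P])
  qed
  have "ext l ** G l = mat 1" for l
  proof (cases "l = c")
    case True
    show ?thesis unfolding True
      by (rule entire_matrix_eq_at[where f = "\<lambda>l. ext l ** G l" and g = "\<lambda>l. mat 1",
            OF entire_matrix_mult[OF entire entire_G] entire_matrix_const one])
  qed (rule one)
  then show "invertible (ext l)" for l
    by (rule matrix_inv_unique(1))
qed

end

text \<open>Write N = F^-1 R P F. The outer factors contribute [N, theta], since dF = F theta. The
  middle one contributes - N a N, since dR = - R P (dE_1) R with dE_1 = F a F^-1.\<close>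

lemma dressed_nilp_has_derivative:
  fixes F :: "real^'n::finite \<Rightarrow> complex \<Rightarrow> complex^'n^'n"
  assumes V: "open V" "x \<in> V" and B: "continuous_on V B" and F: "lax_solution V B F"
    and inv: "\<And>y. y \<in> V \<Longrightarrow> invertible (mat 1 + P ** log_deriv c (F y))"
  shows "((\<lambda>y. dressed_nilp c P (F y)) has_derivative
    (\<lambda>h. commutator (dressed_nilp c P (F x)) (lax_form B c x h)
         - dressed_nilp c P (F x) ** dg h ** dressed_nilp c P (F x))) (at x)"
proof -
  define R where "R = (\<lambda>y. matrix_inv (mat 1 + P ** log_deriv c (F y)))"
  define N where "N = dressed_nilp c P (F x)"
  let ?Fi = "matrix_inv (F x c)"
  have N: "N = ?Fi ** R x ** P ** F x c"
    by (simp add: N_def dressed_nilp_def R_def)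
  have "(R has_derivative (\<lambda>h. - (R x ** (P ** (F x c ** dg h ** ?Fi)) ** R x))) (at x)"
    unfolding R_def
    by (rule has_derivative_matrix_inv[OF V inv])
      (auto intro!: derivative_eq_intros bounded_linear.has_derivative[OF mm.bounded_linear_right]
        log_deriv_has_derivative[OF V B F])
  then have "((\<lambda>y. R y ** P) has_derivative
      (\<lambda>h. - (R x ** (P ** (F x c ** dg h ** ?Fi)) ** R x) ** P)) (at x)"
    by (rule bounded_linear.has_derivative[OF mm.bounded_linear_left])
  from mm.FDERIV[OF lax_solution_inv_has_derivative[OF V F, of c]
      mm.FDERIV[OF this lax_solution_has_derivative[OF F V(2), of c]]]
  have "((\<lambda>y. matrix_inv (F y c) ** (R y ** P ** F y c)) has_derivative
     (\<lambda>h. ?Fi ** (R x ** P ** (F x c ** lax_form B c x h)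
         + - (R x ** (P ** (F x c ** dg h ** ?Fi)) ** R x) ** P ** F x c)
        + - (lax_form B c x h ** ?Fi) ** (R x ** P ** F x c))) (at x)" .
  moreover have "?Fi ** (R x ** P ** (F x c ** lax_form B c x h)
         + - (R x ** (P ** (F x c ** dg h ** ?Fi)) ** R x) ** P ** F x c)
        + - (lax_form B c x h ** ?Fi) ** (R x ** P ** F x c)
      = commutator N (lax_form B c x h) - N ** dg h ** N" for h
    by (simp add: N commutator_def matrix_ring_simps)
  ultimately have "((\<lambda>y. matrix_inv (F y c) ** (R y ** P ** F y c)) has_derivative
      (\<lambda>h. commutator N (lax_form B c x h) - N ** dg h ** N)) (at x)"
    by simp
  moreover have "matrix_inv (F y c) ** (R y ** P ** F y c) = dressed_nilp c P (F y)" for y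
    by (simp add: dressed_nilp_def R_def matrix_mul_assoc)
  ultimately show ?thesis
    unfolding N_def by simp
qed

text \<open>Differentiating \<open>m\<^bsub>c,1,P\<^esub> F m\<^bsub>c,1,N\<^esub>\<^sup>-\<^sup>1\<close>: off the pole this is the gauge
  transformation rule, at the pole the form is obtained as a limit in the spectral parameter.\<close>

lemma dressed_lax_solution:
  fixes F :: "real^'n::finite \<Rightarrow> complex \<Rightarrow> complex^'n^'n"
  assumes V: "open V" and B: "continuous_on V B" and F: "lax_solution V B F" and P: "P ** P = 0"
    and inv: "\<And>y. y \<in> V \<Longrightarrow> invertible (mat 1 + P ** log_deriv c (F y))"
  shows "lax_solution V (\<lambda>x. B x - dressed_nilp c P (F x))
    (\<lambda>x. nilpotent_dressing.ext c P (F x))"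
proof -
  define N where "N = (\<lambda>x. dressed_nilp c P (F x))"
  define G where "G = (\<lambda>x. nilpotent_dressing.ext c P (F x))"
  have nd: "nilpotent_dressing c P (F x)" if "x \<in> V" for x
    using F P inv that by (simp add: nilpotent_dressing_def lax_solution_def)
  have NN: "N x ** N x = 0" if "x \<in> V" for x
    unfolding N_def by (rule nilpotent_dressing.dressed_nilp_square[OF nd[OF that]])
  have G_eq: "G x l = simple_elem c P l ** F x l ** simple_elem c (- N x) l"
    if "x \<in> V" "l \<noteq> c" for x l
    unfolding G_def N_def by (rule nilpotent_dressing.ext_eq_simple[OF nd[OF that(1)] that(2)])
  have G_GL: "entire_GL (G x)" if "x \<in> V" for x
    unfolding G_def by (rule nilpotent_dressing.entire_GL_ext[OF nd[OF that]])
  have dN: "(N has_derivative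
    (\<lambda>h. commutator (N x) (lax_form B c x h) - N x ** dg h ** N x)) (at x)" if "x \<in> V" for x
    unfolding N_def by (rule dressed_nilp_has_derivative[OF V that B F inv])
  have contN: "continuous_on V N"
    by (intro continuous_at_imp_continuous_on ballI has_derivative_continuous[OF dN])
  define B' where "B' = (\<lambda>x. B x - N x)"
  have contB': "continuous_on V B'"
    unfolding B'_def by (intro continuous_on_diff B contN)
  have off_pole: "((\<lambda>y. G y l) has_derivative (\<lambda>h. G x l ** lax_form B' l x h)) (at x)"
    if x: "x \<in> V" and l: "l \<noteq> c" for x l
  proof -
    define k where "k = 1 / (l - c)"
    have k: "k * (l - c) = 1" "(l - c) * k = 1"
      using l by (simp_all add: k_def)
    let ?m = "simple_elem c P l"
    have "((\<lambda>y. ?m ** (F y l ** (mat 1 - cscale k (N y)))) has_derivative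
        (\<lambda>h. ?m ** (F x l ** (0 - cscale k (commutator (N x) (lax_form B c x h) - N x ** dg h ** N x))
          + F x l ** lax_form B l x h ** (mat 1 - cscale k (N x))))) (at x)"
      by (intro bounded_linear.has_derivative[OF mm.bounded_linear_right] mm.FDERIV
          lax_solution_has_derivative[OF F x] has_derivative_diff has_derivative_const
          bounded_linear.has_derivative[OF bounded_linear_cscale] dN x)
    moreover have "?m ** (F x l ** (0 - cscale k (commutator (N x) (lax_form B c x h) - N x ** dg h ** N x))
          + F x l ** lax_form B l x h ** (mat 1 - cscale k (N x))) = G x l ** lax_form B' l x h" for h
    proof -
      let ?a = "dg h" and ?t = "lax_form B c x h"
      have t: "lax_form B l x h = ?t + cscale (l - c) ?a"
        by (simp add: lax_form_eq cscale_diff_left)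
      have t': "lax_form B' l x h = lax_form B l x h - commutator ?a (N x)"
        by (simp add: lax_form_eq B'_def commutator_def matrix_ring_simps)
      \<comment> \<open>The gauge rule d(1 - k N) + theta (1 - k N) = (1 - k N) theta'. With theta
        expanded around its value at the pole, k (l - c) = 1 and N^2 = 0 make the two sides
        agree.\<close>
      have "(0 - cscale k (commutator (N x) ?t - N x ** ?a ** N x)) + lax_form B l x h ** (mat 1 - cscale k (N x))
          = (mat 1 - cscale k (N x)) ** lax_form B' l x h"
      proof -
        have NNX: "N x ** (N x ** X) = 0" for X
          by (simp add: matrix_mul_assoc NN[OF x] mm.zero_left)
        show ?thesis
          unfolding t' t commutator_def by (simp add: matrix_ring_simps k NNX)
      qed
      then show ?thesis
        by (simp add: G_eq[OF x l] simple_elem_eq[of c "- N x"] k_def[symmetric] mm.add_right[symmetric] flip: matrix_mul_assoc)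
    qed
    ultimately have der: "((\<lambda>y. ?m ** (F y l ** (mat 1 - cscale k (N y)))) has_derivative
        (\<lambda>h. G x l ** lax_form B' l x h)) (at x)"
      by simp
    show ?thesis
      by (rule has_derivative_transform_within_open[OF der V x])
        (simp add: G_eq l simple_elem_eq[of c "- N _"] k_def matrix_mul_assoc)
  qed
  have at_pole: "((\<lambda>y. G y c) has_derivative (\<lambda>h. G x c ** lax_form B' c x h)) (at x)"
    if x: "x \<in> V" for x
  proof -
    define l where "l = (\<lambda>n. c + 1 / of_nat (Suc n) :: complex)"
    have l: "l \<longlonglongrightarrow> c"
      unfolding l_def by (rule LIMSEQ_add_inverse_Suc)
    have l_ne: "l n \<noteq> c" for n
      by (simp add: l_def del: of_nat_Suc)
    have l_at: "filterlim l (at c) sequentially"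
      by (rule filterlim_atI[OF l]) (simp add: l_ne)
    show ?thesis
    proof (rule lax_solutions_limit[OF V x contB' l, where T = "\<lambda>n x. G x (l n)" and ?T0.0 = "\<lambda>y. G y c"])
      show "((\<lambda>y. G y (l n)) has_derivative (\<lambda>h. G x (l n) ** lax_form B' (l n) x h)) (at x)"
        if "x \<in> V" for n x
        by (rule off_pole[OF that l_ne])
      show "(\<lambda>n. G x (l n)) \<longlonglongrightarrow> G x c" if "x \<in> V" for x
        by (rule filterlim_compose[OF entire_matrix_tendsto l_at])
          (use G_GL[OF that] in \<open>simp add: entire_GL_iff\<close>)
    qed
  qed
  have "((\<lambda>y. G y l) has_derivative (\<lambda>h. G x l ** lax_form B' l x h)) (at x)" if "x \<in> V" for x l
    using off_pole[OF that, of l] at_pole[OF that] by (cases "l = c") simp_all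
  then have "lax_solution V B' G"
    unfolding lax_solution_def using G_GL by blast
  then show ?thesis
    unfolding B'_def N_def G_def .
qed

subsection \<open>Uniqueness of the dressing factorization\<close>

lemma eventually_not_in_finite_at_infinity:
  fixes S :: "complex set"
  assumes "finite S"
  shows "eventually (\<lambda>l. l \<notin> S) at_infinity"
proof -
  obtain b where "\<And>l. l \<in> S \<Longrightarrow> norm l \<le> b"
    using finite_imp_bounded[OF assms] unfolding bounded_iff by blast
  then show ?thesis
    unfolding eventually_at_infinity by (intro exI[of _ "b + 1"]) force
qed

text \<open>The quotient hp'^-1 hp is entire and equals hm' hm^-1 near infinity, so it tends to 1
  there and is constant by Liouville. The factors hm are compared only off S, where the
  factorization identity is given.\<close>

lemma factorization_unique:
  fixes hp hm hp' hm' :: "complex \<Rightarrow> complex^'n^'n::finite"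
  assumes hp: "entire_GL hp" "entire_GL hp'"
    and hm: "(hm \<longlongrightarrow> mat 1) at_infinity" "(hm' \<longlongrightarrow> mat 1) at_infinity"
    and S: "finite S" and eq: "\<And>l. l \<notin> S \<Longrightarrow> hp l ** hm l = hp' l ** hm' l"
  shows "hp = hp'" "l \<notin> S \<Longrightarrow> hm l = hm' l"
proof -
  have inv: "invertible (hp l)" "invertible (hp' l)" for l
    using hp by (auto simp: entire_GL_iff)
  define G where "G = (\<lambda>l. matrix_inv (hp' l) ** hp l)"
  have G: "entire_matrix G"
    unfolding G_def using hp by (intro entire_matrix_mult entire_matrix_inv) (auto simp: entire_GL_iff)
  have I: "invertible (mat 1 :: complex^'n^'n)" "matrix_inv (mat 1 :: complex^'n^'n) = mat 1"
    by (rule matrix_inv_unique(1,3)[OF matrix_mul_lid])+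
  have "((\<lambda>l. hm' l ** matrix_inv (hm l)) \<longlongrightarrow> mat 1 ** mat 1) at_infinity"
    using tendsto_matrix_inv(1)[OF hm(1) I(1)] hm(2) unfolding I(2) by (rule mm.tendsto[rotated])
  moreover have "\<forall>\<^sub>F l in at_infinity. hm' l ** matrix_inv (hm l) = G l"
    using tendsto_matrix_inv(2)[OF hm(1) I(1)] eventually_not_in_finite_at_infinity[OF S]
  proof eventually_elim
    case (elim l)
    have "hm' l = matrix_inv (hp' l) ** (hp l ** hm l)"
      by (simp add: eq[OF elim(2)] matrix_inv_mult_cancel[OF inv(2)])
    then show ?case
      by (simp add: G_def matrix_mul_assoc[symmetric] matrix_inv_works[OF elim(1)])
  qed
  ultimately have "(G \<longlongrightarrow> mat 1) at_infinity"
    by (simp add: Lim_transform_eventually)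
  then have G1: "G l = mat 1" for l
    using Liouville_matrix[OF G] by simp
  have "hp l = hp' l" for l
  proof -
    have "hp l = hp' l ** G l"
      by (simp add: G_def matrix_inv_mult_cancel[OF inv(2)])
    then show ?thesis by (simp add: G1)
  qed
  then show hp_eq: "hp = hp'" by auto
  show "hm l = hm' l" if "l \<notin> S"
    using eq[OF that] matrix_inv_mult_cancel(2)[OF inv(2)[of l]] unfolding hp_eq by metis
qed

lemma dress_eqI:
  assumes "dressing_factorization gm gp hp hm"
  shows "dress gm gp = hp"
  unfolding dress_def
proof (rule the_equality)
  show "\<exists>hm. dressing_factorization gm gp hp hm"
    using assms by blast
  fix hp' assume "\<exists>hm. dressing_factorization gm gp hp' hm"
  then obtain hm' where "dressing_factorization gm gp hp' hm'" ..
  then obtain S' where 1: "entire_GL hp'" "(hm' \<longlongrightarrow> mat 1) at_infinity" "finite S'"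
    "\<And>l. l \<notin> S' \<Longrightarrow> gm l ** gp l = hp' l ** hm' l"
    unfolding dressing_factorization_def rational_normalized_def by blast
  from assms obtain S where 2: "entire_GL hp" "(hm \<longlongrightarrow> mat 1) at_infinity" "finite S"
    "\<And>l. l \<notin> S \<Longrightarrow> gm l ** gp l = hp l ** hm l"
    unfolding dressing_factorization_def rational_normalized_def by blast
  show "hp' = hp"
  proof (rule factorization_unique(1)[OF 1(1) 2(1) 1(2) 2(2), of "S \<union> S'"])
    show "finite (S \<union> S')"
      using 1(3) 2(3) by simp
    show "hp' l ** hm' l = hp l ** hm l" if "l \<notin> S \<union> S'" for l
      using 1(4)[of l] 2(4)[of l] that by simp
  qed
qed

text \<open>The entrywise condition of \<open>rational_normalized\<close>, isolated in order to be
  closed under sums and products.\<close>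

definition rational_fun :: "(complex \<Rightarrow> complex) \<Rightarrow> bool" where
  "rational_fun f \<longleftrightarrow> (\<exists>p q. q \<noteq> 0 \<and> (\<forall>l. poly q l \<noteq> 0 \<longrightarrow> f l = poly p l / poly q l))"

lemma rational_fun_const: "rational_fun (\<lambda>l. c)"
  unfolding rational_fun_def by (intro exI[of _ "[:c:]"] exI[of _ 1]) simp

lemma rational_fun_add:
  assumes "rational_fun f" "rational_fun g"
  shows "rational_fun (\<lambda>l. f l + g l)"
proof -
  obtain p q r s where "q \<noteq> 0" "\<And>l. poly q l \<noteq> 0 \<Longrightarrow> f l = poly p l / poly q l"
    "s \<noteq> 0" "\<And>l. poly s l \<noteq> 0 \<Longrightarrow> g l = poly r l / poly s l"
    using assms unfolding rational_fun_def by blast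
  then show ?thesis
    unfolding rational_fun_def
    by (intro exI[of _ "p * s + r * q"] exI[of _ "q * s"]) (auto simp: field_simps)
qed

lemma rational_fun_mult:
  assumes "rational_fun f" "rational_fun g"
  shows "rational_fun (\<lambda>l. f l * g l)"
proof -
  obtain p q r s where "q \<noteq> 0" "\<And>l. poly q l \<noteq> 0 \<Longrightarrow> f l = poly p l / poly q l"
    "s \<noteq> 0" "\<And>l. poly s l \<noteq> 0 \<Longrightarrow> g l = poly r l / poly s l"
    using assms unfolding rational_fun_def by blast
  then show ?thesis
    unfolding rational_fun_def
    by (intro exI[of _ "p * r"] exI[of _ "q * s"]) auto
qed

lemma rational_fun_sum:
  "(\<And>i. i \<in> I \<Longrightarrow> rational_fun (f i)) \<Longrightarrow> rational_fun (\<lambda>l. \<Sum>i\<in>I. f i l)"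
  by (induction I rule: infinite_finite_induct) (simp_all add: rational_fun_const rational_fun_add)

lemma rational_fun_pole: "rational_fun (\<lambda>l. 1 / (l - c))"
  unfolding rational_fun_def by (intro exI[of _ 1] exI[of _ "[:- c, 1:]"]) simp

lemma rational_normalized_simple_elem: "rational_normalized (simple_elem c P)"
  unfolding rational_normalized_def rational_fun_def[symmetric]
proof (intro conjI allI)
  show "rational_fun (\<lambda>l. simple_elem c P l $ i $ j)" for i j
    unfolding simple_elem_eq vector_add_component cscale_nth
    by (intro rational_fun_add rational_fun_mult rational_fun_const rational_fun_pole)
  have "filterlim (\<lambda>l. - c + l) at_infinity at_infinity"
    by (rule tendsto_add_filterlim_at_infinity[OF tendsto_const filterlim_ident])
  then have "((\<lambda>l. inverse (- c + l)) \<longlongrightarrow> 0) at_infinity"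
    by (rule filterlim_compose[OF tendsto_inverse_0])
  from mm.tendsto[OF tendsto_mat[OF this] tendsto_const[of P]]
  have "((\<lambda>l. mat (1 / (l - c)) ** P) \<longlongrightarrow> 0) at_infinity"
    by (simp add: inverse_eq_divide mm.zero_left)
  from tendsto_add[OF tendsto_const[of "mat 1"] this]
  show "(simple_elem c P \<longlongrightarrow> mat 1) at_infinity"
    by (simp add: simple_elem_def[abs_def])
qed

lemma rational_normalized_mult:
  assumes "rational_normalized f" "rational_normalized g"
  shows "rational_normalized (\<lambda>l. f l ** g l)"
  using assms unfolding rational_normalized_def rational_fun_def[symmetric]
proof (elim conjE, intro conjI allI)
  fix i j
  assume "\<forall>i j. rational_fun (\<lambda>l. f l $ i $ j)" "\<forall>i j. rational_fun (\<lambda>l. g l $ i $ j)"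
  then show "rational_fun (\<lambda>l. (f l ** g l) $ i $ j)"
    by (simp add: matrix_matrix_mult_def rational_fun_sum rational_fun_mult)
next
  assume "(f \<longlongrightarrow> mat 1) at_infinity" "(g \<longlongrightarrow> mat 1) at_infinity"
  from mm.tendsto[OF this] show "((\<lambda>l. f l ** g l) \<longlongrightarrow> mat 1) at_infinity"
    by simp
qed

subsection \<open>Symmetry and reality\<close>

lemma transpose_lax_form:
  assumes "transpose (B x) = B x"
  shows "transpose (lax_form B (- l) x h) = - lax_form B l x h"
  by (simp add: lax_form_eq commutator_def transpose_simps transpose_cscale assms)

text \<open>For symmetric B the bracket [a, B] is skew, so the transposed form at -l is minus the
  form at l and the product has derivative zero. C is kept general, at a single l, so that both E
  and its complex conjugate can be inserted; comparing the two inverses gives the reality of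
  E.\<close>

lemma lax_solution_orthogonal:
  fixes C :: "real^'n::finite \<Rightarrow> complex^'n^'n"
  assumes U: "open U" "connected U" "0 \<in> U" and B: "\<And>x. x \<in> U \<Longrightarrow> transpose (B x) = B x"
    and E: "lax_solution U B E" "E 0 (- l) = mat 1"
    and C: "\<And>x. x \<in> U \<Longrightarrow> (C has_derivative (\<lambda>h. C x ** lax_form B l x h)) (at x)" "C 0 = mat 1"
    and x: "x \<in> U"
  shows "C x ** transpose (E x (- l)) = mat 1"
proof -
  have "((\<lambda>y. C y ** transpose (E y (- l))) has_derivative (\<lambda>h. 0)) (at x)" if x: "x \<in> U" for x
  proof -
    have "((\<lambda>y. C y ** transpose (E y (- l))) has_derivative
        (\<lambda>h. C x ** transpose (E x (- l) ** lax_form B (- l) x h)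
             + C x ** lax_form B l x h ** transpose (E x (- l)))) (at x)"
      by (intro mm.FDERIV C x bounded_linear.has_derivative[OF bounded_linear_transpose]
          lax_solution_has_derivative[OF E(1)])
    then show ?thesis
      by (simp add: matrix_transpose_mul transpose_lax_form[of B x, OF B[OF x]] mm.minus_left mm.minus_right
          matrix_mul_assoc)
  qed
  from has_derivative_zero_unique_connected[OF U(1,2) this x U(3)] show ?thesis
    by (simp add: C E)
qed

lemma cnj_mat_lax_form:
  assumes "cnj_mat (B x) = B x"
  shows "cnj_mat (lax_form B (cnj l) x h) = lax_form B l x h"
  by (simp add: lax_form_eq commutator_def cnj_mat_simps assms)

lemma transpose_simple_elem: "transpose (simple_elem c P (- l)) = simple_elem (- c) (- transpose P) l"
proof -
  have "1 / (- l - c) = - (1 / (l - - c))"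
    by (metis diff_minus_eq_add minus_add_distrib minus_divide_right uminus_add_conv_diff
        add.commute)
  then show ?thesis
    by (simp only: simple_elem_eq transpose_simps transpose_cscale transpose_mat)
      (simp only: cscale_simps)
qed

lemma cnj_mat_simple_elem: "cnj_mat (simple_elem c P (cnj l)) = simple_elem (cnj c) (cnj_mat P) l"
  by (simp add: simple_elem_eq cnj_mat_simps)

lemma cnj_mat_matrix_inv:
  assumes "invertible A"
  shows "cnj_mat (matrix_inv A) = matrix_inv (cnj_mat A)"
proof -
  have "cnj_mat A ** cnj_mat (matrix_inv A) = mat 1"
    by (simp flip: cnj_mat_simps(4) add: matrix_inv_works[OF assms] cnj_mat_simps(6))
  then show ?thesis
    by (simp add: matrix_inv_unique(3))
qed

lemma entire_GL_cnj:
  assumes "entire_GL f"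
  shows "entire_GL (\<lambda>l. cnj_mat (f (cnj l)))"
  unfolding entire_GL_def
proof (intro conjI allI)
  fix i j
  have "(\<lambda>l. f l $ i $ j) holomorphic_on cnj ` UNIV"
    using assms by (auto simp: entire_GL_def intro: holomorphic_on_subset)
  from holomorphic_on_compose_cnj_cnj[OF this]
  show "(\<lambda>l. cnj_mat (f (cnj l)) $ i $ j) holomorphic_on UNIV"
    by (simp add: o_def)
next
  fix l
  have "invertible (f (cnj l))"
    using assms by (simp add: entire_GL_def)
  then have "cnj_mat (f (cnj l)) ** cnj_mat (matrix_inv (f (cnj l))) = mat 1"
    by (simp flip: cnj_mat_simps(4) add: matrix_inv_works cnj_mat_simps(6))
  then show "invertible (cnj_mat (f (cnj l)))"
    by (rule matrix_inv_unique(1))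
qed

lemma invertible_transpose:
  fixes A :: "complex^'n^'n::finite"
  assumes "invertible A"
  shows "invertible (transpose A)"
  using assms by (simp add: invertible_det_nz)

text \<open>The fixed points of this involution are the loops with f(-l)^t f(l) = 1. It sends the
  left factor of the dressing factorization to an admissible competitor.\<close>

lemma entire_GL_inv_transpose:
  assumes "entire_GL f"
  shows "entire_GL (\<lambda>l. matrix_inv (transpose (f (- l))))"
  unfolding entire_GL_iff
proof (intro conjI allI)
  have inv: "invertible (transpose (f (- l)))" for l
    using assms by (intro invertible_transpose) (simp add: entire_GL_def)
  have "(\<lambda>l. f (- l) $ i $ j) holomorphic_on UNIV" for i j
  proof -
    have "(\<lambda>l. f l $ i $ j) \<circ> uminus holomorphic_on UNIV"
      using assms by (intro holomorphic_on_compose holomorphic_intros)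
        (auto simp: entire_GL_def intro: holomorphic_on_subset)
    then show ?thesis by (simp add: o_def)
  qed
  then have "entire_matrix (\<lambda>l. transpose (f (- l)))"
    by (simp add: entire_matrix_def transpose_def)
  then show "entire_matrix (\<lambda>l. matrix_inv (transpose (f (- l))))"
    using inv by (rule entire_matrix_inv)
  show "invertible (matrix_inv (transpose (f (- l))))" for l
    using matrix_inv_unique(2)[OF matrix_inv_works(1)[OF inv]] .
qed

text \<open>Two evaluations recover the residue at infinity of a product of two simple elements.\<close>

lemma simple_elem_pair_sum:
  fixes A B :: "complex^'n^'n::finite"
  assumes "c \<noteq> 0"
  defines "s \<equiv> \<lambda>l. simple_elem c A l ** simple_elem (- c) B l - mat 1"
  shows "A + B = cscale (8 * c) (s (3 * c)) - cscale (3 * c) (s (2 * c))"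
    "A + B = cscale (3 * c) (s (- (2 * c))) - cscale (8 * c) (s (- (3 * c)))"
proof -
  have sub: "cscale p X - cscale q X = cscale (p - q) X" for p q and X :: "complex^'n^'n"
    by (simp add: cscale_diff_left)
  have 3: "s (3 * c) = cscale (1 / (2 * c)) A + cscale (1 / (4 * c)) B + cscale (1 / (8 * c * c)) (A ** B)"
    by (simp add: s_def simple_elem_eq matrix_ring_simps mult_ac)
  have 2: "s (2 * c) = cscale (1 / c) A + cscale (1 / (3 * c)) B + cscale (1 / (3 * c * c)) (A ** B)"
    by (simp add: s_def simple_elem_eq matrix_ring_simps mult_ac)
  \<comment> \<open>The weights 8c and 3c give the product A B the same coefficient 1/c, so it
    cancels. What remains is 4 - 3 times A and 2 - 1 times B.\<close>
  have "cscale (8 * c) (s (3 * c)) - cscale (3 * c) (s (2 * c))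
    = cscale 4 A - cscale 3 A + (cscale 2 B - cscale 1 B)"
    unfolding 2 3 using assms by (simp add: cscale_distrib)
  then show "A + B = cscale (8 * c) (s (3 * c)) - cscale (3 * c) (s (2 * c))"
    unfolding sub by simp
  \<comment> \<open>The mirrored points are for a product with the two poles exchanged: using one
    formula for c and the other for -c evaluates both products at the same points.\<close>
  have 3: "s (- (3 * c)) = cscale (1 / (8 * c * c)) (A ** B) - cscale (1 / (4 * c)) A - cscale (1 / (2 * c)) B"
    by (simp add: s_def simple_elem_eq matrix_ring_simps mult_ac)
  have 2: "s (- (2 * c)) = cscale (1 / (3 * c * c)) (A ** B) - cscale (1 / (3 * c)) A - cscale (1 / c) B"
    by (simp add: s_def simple_elem_eq matrix_ring_simps mult_ac)
  have "cscale (3 * c) (s (- (2 * c))) - cscale (8 * c) (s (- (3 * c)))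
    = cscale 2 A - cscale 1 A + (cscale 4 B - cscale 3 B)"
    unfolding 2 3 using assms by (simp add: cscale_distrib)
  then show "A + B = cscale (3 * c) (s (- (2 * c))) - cscale (8 * c) (s (- (3 * c)))"
    unfolding sub by simp
qed

subsection \<open>The partner of a nilpotent matrix\<close>

text \<open>The last two equations are the residues at \<alpha> and -\<alpha> of the identity in
  \<open>dressing_elem_eq_transposed\<close>. After scaling by e everything lives in the algebra of
  n, t = n^t and the symmetric inverse R of 1 + t n, where n^2 = t^2 = 0.\<close>

lemma partner_eqs:
  fixes N :: "complex^'n^'n::finite"
  assumes a: "\<alpha> \<noteq> 0" and N: "N ** N = 0"
    and K: "invertible (mat 1 + (1 / (4 * \<alpha>\<^sup>2)) *\<^sub>R (transpose N ** N))"
  defines "N' \<equiv> partner \<alpha> N" and "e \<equiv> complex_of_real (1 / (2 * \<alpha>))"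
  shows "N' ** N' = 0"
    "N + cscale e (N' ** N) = transpose N' + cscale e (transpose N' ** transpose N)"
    "N' - cscale e (N' ** N) = transpose N - cscale e (transpose N' ** transpose N)"
proof -
  define n where "n = cscale e N"
  define t where "t = transpose n"
  define K where "K = mat 1 + t ** n"
  define R where "R = matrix_inv K"
  have nn: "n ** n = 0"
    by (simp add: n_def N)
  have tt: "t ** t = 0"
    by (simp add: t_def matrix_transpose_mul[symmetric] nn transpose_simps)
  have ee: "e * e = complex_of_real (1 / (4 * \<alpha>\<^sup>2))"
    by (simp add: e_def power2_eq_square)
  have e: "e \<noteq> 0"
    using a by (simp add: e_def)
  have tn: "t = cscale e (transpose N)"
    by (simp add: t_def n_def transpose_cscale)
  have K_eq: "mat 1 + (1 / (4 * \<alpha>\<^sup>2)) *\<^sub>R (transpose N ** N) = K"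
    by (simp only: K_def tn n_def scaleR_eq_cscale matrix_mult_cscale cscale_simps ee)
  have Kinv: "invertible K"
    using assms(3) K_eq by simp
  have R: "K ** R = mat 1" "R ** K = mat 1"
    unfolding R_def by (rule matrix_inv_works[OF Kinv])+
  have Kt: "transpose K = K"
    by (simp add: K_def t_def transpose_simps)
  have Rt: "transpose R = R"
  proof -
    have "K ** transpose R = mat 1"
      using arg_cong[OF R(2), of transpose] by (simp add: matrix_transpose_mul Kt)
    then have "matrix_inv K = transpose R"
      by (rule matrix_inv_unique(3))
    then show ?thesis
      unfolding R_def[symmetric] by (rule sym)
  qed
  \<comment> \<open>Since t^2 = 0, t K = t, so t absorbs the inverse R as well; transposition gives
    R n = n.\<close>
  have tR: "t ** R = t"
  proof -
    have "t ** K = t"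
      by (simp add: K_def matrix_ring_simps) (simp add: matrix_mul_assoc tt mm.zero_left)
    then have "t ** R = t ** (K ** R)"
      by (simp add: matrix_mul_assoc)
    then show ?thesis by (simp add: R)
  qed
  have Rn: "R ** n = n"
    using arg_cong[OF tR, of transpose] by (simp add: matrix_transpose_mul Rt t_def)
  have tnR: "t ** n ** R = mat 1 - R" "R ** t ** n = mat 1 - R"
    using R by (simp_all add: K_def mm.add_left mm.add_right algebra_simps matrix_mul_assoc)
  define p where "p = (mat 1 - n) ** R ** t ** (mat 1 + n)"
  have p: "p = cscale e N'"
    unfolding N'_def partner_def K_eq R_def[symmetric] p_def
    unfolding scaleR_eq_cscale e_def[symmetric] n_def[symmetric]
    by (simp add: tn)
  have pt: "transpose p = (mat 1 + t) ** n ** R ** (mat 1 - t)"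
    by (simp add: p_def transpose_simps Rt t_def matrix_mul_assoc)
  have "p ** p = 0"
  proof -
    \<comment> \<open>Thus p is R t conjugated by 1 - n, and (R t)^2 = R (t R) t = R t^2 =
      0.\<close>
    have one: "(mat 1 + n) ** (mat 1 - n) = mat 1"
      by (simp add: matrix_ring_simps nn)
    have "p ** p = (mat 1 - n) ** R ** (t ** ((mat 1 + n) ** (mat 1 - n)) ** R) ** t ** (mat 1 + n)"
      by (simp only: p_def matrix_mul_assoc)
    also have "\<dots> = (mat 1 - n) ** R ** (t ** t) ** (mat 1 + n)"
      by (simp only: one matrix_mul_rid tR matrix_mul_assoc)
    finally show ?thesis
      by (simp add: tt mm.zero_left mm.zero_right)
  qed
  then have "cscale (e * e) (N' ** N') = 0"
    by (simp add: p)
  then have "cscale (1 / (e * e)) (cscale (e * e) (N' ** N')) = 0"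
    by (simp only: cscale_simps)
  then show "N' ** N' = 0"
    using e by simp
  have pn: "p ** n = (mat 1 - n) ** R ** t ** n"
    by (simp add: p_def matrix_ring_simps nn)
  have ptt: "transpose p ** t = (mat 1 + t) ** n ** R ** t"
    by (simp add: pt matrix_ring_simps tt)
  have pnR: "p ** n = mat 1 - R - n + n ** R"
    using arg_cong[OF tnR(2), of "\<lambda>X. (mat 1 - n) ** X"]
    by (simp add: pn matrix_ring_simps)
  have pttR: "transpose p ** t = n ** (R ** t) + t - R ** t"
    using arg_cong[OF tnR(1), of "\<lambda>X. X ** t"]
    by (simp add: ptt matrix_ring_simps)
  have "(mat 1 - t) ** (mat 1 + t) = mat 1"
    by (simp add: matrix_ring_simps tt)
  then have "transpose p ** (mat 1 + t) = (mat 1 + t) ** n ** R"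
    unfolding pt by (simp add: matrix_mul_assoc[symmetric])
  then have "transpose p + transpose p ** t = n ** R + t ** n ** R"
    by (simp add: mm.add_left mm.add_right)
  then have A: "n + p ** n = transpose p + transpose p ** t"
    unfolding pnR tnR by simp
  have p': "p = R ** t - n ** (R ** t) + p ** n"
    by (simp add: p_def matrix_ring_simps nn)
  have B: "p - p ** n = t - transpose p ** t"
    unfolding pttR by (subst p') simp
  have un: "X = Y" if "cscale e X = cscale e Y" for X Y :: "complex^'n^'n"
    using e that by (simp add: vec_eq_iff)
  show "N + cscale e (N' ** N) = transpose N' + cscale e (transpose N' ** transpose N)"
    by (rule un) (use A in \<open>simp add: p n_def tn transpose_cscale cscale_distrib\<close>)
  show "N' - cscale e (N' ** N) = transpose N - cscale e (transpose N' ** transpose N)"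
    by (rule un) (use B in \<open>simp add: p n_def tn transpose_cscale cscale_distrib\<close>)
qed

text \<open>The right-hand side is the inverse of s(-l)^t, so this is the orthogonality of s. The
  partial fraction \<open>u * v = e * u - e * v\<close> reduces both products to their residues at
  the two poles, which \<open>partner_eqs\<close> matches.\<close>

lemma dressing_elem_eq_transposed:
  fixes N :: "complex^'n^'n::finite"
  assumes a: "\<alpha> \<noteq> 0" and N: "N ** N = 0"
    and K: "invertible (mat 1 + (1 / (4 * \<alpha>\<^sup>2)) *\<^sub>R (transpose N ** N))"
    and l: "l \<noteq> of_real \<alpha>" "l \<noteq> - of_real \<alpha>"
  shows "dressing_elem \<alpha> N l
    = simple_elem (of_real \<alpha>) (transpose (partner \<alpha> N)) l ** simple_elem (- of_real \<alpha>) (transpose N) l"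
proof -
  define c where "c = complex_of_real \<alpha>"
  have c: "c \<noteq> 0" and lc: "l \<noteq> c" "l \<noteq> - c"
    using a l by (simp_all add: c_def)
  define e where "e = complex_of_real (1 / (2 * \<alpha>))"
  have e: "e = 1 / (2 * c)"
    by (simp add: e_def c_def)
  define u where "u = 1 / (l - c)"
  define v where "v = 1 / (l + c)"
  have uv: "u * v = e * u - e * v"
  proof -
    have "l - c \<noteq> 0" "l + c \<noteq> 0"
      using lc by (simp_all add: eq_neg_iff_add_eq_0)
    then show ?thesis
      using c unfolding u_def v_def e by (simp add: divide_simps)
  qed
  define M where "M = partner \<alpha> N"
  note eqs = partner_eqs[OF a N K, folded M_def e_def]
  have "dressing_elem \<alpha> N l = mat 1 + cscale u N + cscale v M + cscale (u * v) (M ** N)"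
    by (simp add: dressing_elem_def simple_elem_eq u_def v_def c_def[symmetric] M_def[symmetric] matrix_ring_simps mult.commute)
  also have "\<dots> = mat 1 + cscale u (N + cscale e (M ** N)) + cscale v (M - cscale e (M ** N))"
    unfolding uv by (simp add: cscale_distrib cscale_diff_left mult.commute)
  also have "\<dots> = mat 1 + cscale u (transpose M) + cscale v (transpose N) + cscale (u * v) (transpose M ** transpose N)"
    unfolding uv eqs by (simp add: cscale_distrib cscale_diff_left mult.commute)
  also have "\<dots> = simple_elem c (transpose M) l ** simple_elem (- c) (transpose N) l"
    by (simp add: simple_elem_eq u_def v_def matrix_ring_simps) (simp add: mult.commute)
  finally show ?thesis
    by (simp add: c_def M_def)
qed

lemma cnj_mat_partner:
  fixes N :: "complex^'n^'n::finite"
  assumes N: "cnj_mat N = N"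
    and K: "invertible (mat 1 + (1 / (4 * \<alpha>\<^sup>2)) *\<^sub>R (transpose N ** N))"
  shows "cnj_mat (partner \<alpha> N) = partner \<alpha> N"
proof -
  have "cnj_mat (r *\<^sub>R A) = r *\<^sub>R cnj_mat A" for r and A :: "complex^'n^'n"
    by (simp add: scaleR_eq_cscale cnj_mat_simps)
  then show ?thesis
    by (simp add: partner_def cnj_mat_simps cnj_mat_matrix_inv[OF K] N)
qed

subsection \<open>Classes of differentiability\<close>

lemma partial_deriv_eq: "(f has_derivative D) (at x) \<Longrightarrow> partial_deriv j f x = D (axis j 1)"
  by (simp add: partial_deriv_def frechet_derivative_at[symmetric])

lemma C_class_subset: "C_class k U f \<Longrightarrow> V \<subseteq> U \<Longrightarrow> C_class k V f"
  by (induction k arbitrary: f) (auto intro: continuous_on_subset)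

lemma C_class_SucD: "C_class (Suc k) V f \<Longrightarrow> C_class k V f"
proof (induction k arbitrary: f)
  case 0
  then show ?case
    by (auto intro!: continuous_at_imp_continuous_on differentiable_imp_continuous_within)
next
  case (Suc k)
  then show ?case
    using C_class.simps(2) by blast
qed

lemma C_class_le: "C_class k V f \<Longrightarrow> m \<le> k \<Longrightarrow> C_class m V f"
proof (induction k)
  case (Suc k)
  then show ?case
    using C_class_SucD le_Suc_eq by blast
qed simp

lemma C_class_cong:
  assumes "open V" "\<And>x. x \<in> V \<Longrightarrow> f x = g x" "C_class k V f"
  shows "C_class k V g"
  using assms(2,3)
proof (induction k arbitrary: f g)
  case 0
  then show ?case by (simp cong: continuous_on_cong)
next
  case (Suc k)
  have der: "(g has_derivative frechet_derivative f (at x)) (at x)" if x: "x \<in> V" for x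
  proof -
    have "(f has_derivative frechet_derivative f (at x)) (at x)"
      using Suc.prems(2) x frechet_derivative_works by auto
    then show ?thesis
      by (rule has_derivative_transform_within_open[OF _ assms(1) x Suc.prems(1)])
  qed
  then have "partial_deriv j f x = partial_deriv j g x" if "x \<in> V" for x j
    using partial_deriv_eq[OF der[OF that], of j] by (simp add: partial_deriv_def)
  then show ?case
    using der Suc.IH[of "partial_deriv j f" "partial_deriv j g" for j] Suc.prems(2)
    by (auto simp: differentiable_def)
qed

text \<open>The functions \<open>partial_deriv j f\<close> are total; on an open set any known
  derivative of f determines them, so their values elsewhere do not matter.\<close>

lemma C_class_SucI:
  assumes "open V" "\<And>x. x \<in> V \<Longrightarrow> (f has_derivative D x) (at x)"
    "\<And>j. C_class k V (\<lambda>x. D x (axis j 1))"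
  shows "C_class (Suc k) V f"
proof -
  have "C_class k V (partial_deriv j f)" for j
    by (rule C_class_cong[OF assms(1) _ assms(3)]) (simp add: partial_deriv_eq[OF assms(2)])
  then show ?thesis
    using assms(2) by (auto simp: differentiable_def)
qed

lemma C_class_has_derivative:
  assumes "C_class (Suc k) V f" "x \<in> V"
  shows "(f has_derivative frechet_derivative f (at x)) (at x)"
  using assms by (simp add: frechet_derivative_works[symmetric])

lemma C_class_const: "open V \<Longrightarrow> C_class k V (\<lambda>x. A)"
proof (induction k arbitrary: A)
  case (Suc k)
  show ?case
    by (rule C_class_SucI[OF Suc.prems has_derivative_const Suc.IH[OF Suc.prems]])
qed simp

lemma C_class_linear:
  assumes "open V" "bounded_linear L"
  shows "C_class k V f \<Longrightarrow> C_class k V (\<lambda>x. L (f x))"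
proof (induction k arbitrary: f)
  case 0
  then show ?case
    by (simp add: bounded_linear.continuous_on[OF assms(2)])
next
  case (Suc k)
  show ?case
  proof (rule C_class_SucI[OF assms(1)])
    show "((\<lambda>x. L (f x)) has_derivative (\<lambda>h. L (frechet_derivative f (at x) h))) (at x)"
      if "x \<in> V" for x
      by (rule bounded_linear.has_derivative[OF assms(2) C_class_has_derivative[OF Suc.prems that]])
    show "C_class k V (\<lambda>x. L (frechet_derivative f (at x) (axis j 1)))" for j
      unfolding partial_deriv_def[symmetric] using Suc by simp
  qed
qed

lemma C_class_add:
  assumes "open V"
  shows "C_class k V f \<Longrightarrow> C_class k V g \<Longrightarrow> C_class k V (\<lambda>x. f x + g x)"
proof (induction k arbitrary: f g)
  case 0
  then show ?case
    by (simp add: continuous_on_add)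
next
  case (Suc k)
  show ?case
  proof (rule C_class_SucI[OF assms(1)])
    show "((\<lambda>x. f x + g x) has_derivative
        (\<lambda>h. frechet_derivative f (at x) h + frechet_derivative g (at x) h)) (at x)"
      if "x \<in> V" for x
      by (intro has_derivative_add C_class_has_derivative[OF Suc.prems(1) that]
          C_class_has_derivative[OF Suc.prems(2) that])
    show "C_class k V (\<lambda>x. frechet_derivative f (at x) (axis j 1) + frechet_derivative g (at x) (axis j 1))" for j
      unfolding partial_deriv_def[symmetric] using Suc by simp
  qed
qed

lemma C_class_diff:
  assumes "open V" "C_class k V f" "C_class k V g"
  shows "C_class k V (\<lambda>x. f x - g x)"
  using C_class_add[OF assms(1,2) C_class_linear[OF assms(1) _ assms(3), of uminus]]
  by (simp add: bounded_linear_minus bounded_linear_ident)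

lemma C_class_mult:
  assumes "open V"
  shows "C_class k V f \<Longrightarrow> C_class k V g \<Longrightarrow> C_class k V (\<lambda>x. f x ** g x)"
proof (induction k arbitrary: f g)
  case 0
  then show ?case
    by (simp add: mm.continuous_on)
next
  case (Suc k)
  show ?case
  proof (rule C_class_SucI[OF assms(1)])
    show "((\<lambda>x. f x ** g x) has_derivative
        (\<lambda>h. f x ** frechet_derivative g (at x) h + frechet_derivative f (at x) h ** g x)) (at x)"
      if "x \<in> V" for x
      by (intro mm.FDERIV C_class_has_derivative[OF Suc.prems(1) that]
          C_class_has_derivative[OF Suc.prems(2) that])
    show "C_class k V (\<lambda>x. f x ** frechet_derivative g (at x) (axis j 1)
        + frechet_derivative f (at x) (axis j 1) ** g x)" for j
      unfolding partial_deriv_def[symmetric]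
      using Suc C_class_SucD[OF Suc.prems(1)] C_class_SucD[OF Suc.prems(2)]
      by (intro C_class_add[OF assms] Suc.IH) simp_all
  qed
qed

lemma C_class_commutator:
  "open V \<Longrightarrow> C_class k V f \<Longrightarrow> C_class k V g \<Longrightarrow> C_class k V (\<lambda>x. commutator (f x) (g x))"
  unfolding commutator_def by (intro C_class_diff C_class_mult)

lemma C_class_lax_form:
  "open V \<Longrightarrow> C_class k V B \<Longrightarrow> C_class k V (\<lambda>x. lax_form B c x h)"
  unfolding lax_form_eq by (intro C_class_add C_class_const C_class_commutator)

text \<open>The right-hand side is polynomial in N and B and contains no derivatives, so class m of
  both gives class m + 1 of N. N thus inherits the full class of B without loss.\<close>

lemma C_class_bootstrap:
  assumes V: "open V" and B: "C_class k V B"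
    and N: "\<And>x. x \<in> V \<Longrightarrow> (N has_derivative
      (\<lambda>h. commutator (N x) (lax_form B c x h) - N x ** dg h ** N x)) (at x)"
  shows "C_class k V N"
proof -
  have "C_class m V N" if "m \<le> k" for m
    using that
  proof (induction m)
    case 0
    show ?case
      using has_derivative_continuous[OF N] by (simp add: continuous_at_imp_continuous_on)
  next
    case (Suc m)
    then have "C_class m V B" "C_class m V N"
      using C_class_le[OF B] by simp_all
    then show ?case
      by (intro C_class_SucI[OF V N] C_class_diff C_class_mult C_class_commutator C_class_lax_form
          C_class_const V)
  qed
  then show ?thesis by simp
qed

subsection \<open>Flatness\<close>

text \<open>The nonlinear equations for \<open>B - N\<close> follow algebraically from those for \<open>B\<close> and the
  Riccati type equation for \<open>N\<close>, so that no second derivatives of a frame are needed.\<close>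

lemma flatness_step:
  fixes a b :: "complex^'n^'n::finite"
  assumes ab: "a ** b = b ** a" and N: "N ** N = 0"
    and flat: "commutator a Bb - commutator b Ba = commutator (commutator a B) (commutator b B)"
    and Na: "Na = commutator N (cscale c a + commutator a B) - N ** a ** N"
    and Nb: "Nb = commutator N (cscale c b + commutator b B) - N ** b ** N"
  shows "commutator a (Bb - Nb) - commutator b (Ba - Na)
    = commutator (commutator a (B - N)) (commutator b (B - N))"
proof -
  have NN: "N ** (N ** X) = 0" and abX: "a ** (b ** X) = b ** (a ** X)" for X
    by (simp_all add: matrix_mul_assoc N mm.zero_left ab)
  have "commutator a (Bb - Nb) - commutator b (Ba - Na)
      - commutator (commutator a (B - N)) (commutator b (B - N))
    = commutator a Bb - commutator b Ba - commutator (commutator a B) (commutator b B)"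
    unfolding Na Nb commutator_def by (simp add: matrix_ring_simps ab abX N NN)
  then show ?thesis
    by (simp add: flat)
qed

text \<open>Entry (i,j) of the bracket is (h_i - h_j) A_ij. Hence dropping the diagonal changes
  neither the Lax form nor the nonlinear equations.\<close>

lemma commutator_dg_off_diag: "commutator (dg h) (off_diag A) = commutator (dg h) A"
  by (simp add: vec_eq_iff commutator_def dg_mult_nth mult_dg_nth off_diag_def)

lemma bounded_linear_off_diag: "bounded_linear off_diag"
  unfolding linear_conv_bounded_linear[symmetric] linear_iff
  by (simp add: vec_eq_iff off_diag_def)

lemma commutator_diff_right: "commutator A (B - C) = commutator A B - commutator A C"
  by (simp add: commutator_def matrix_ring_simps)

subsection \<open>The dressed solution\<close>

text \<open>Only the germ at c enters. This lets the formula with a spurious value at one pole be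
  replaced by its continuation when dressing at the other pole.\<close>

lemma dressed_nilp_cong:
  assumes "open S" "c \<in> S" "\<And>l. l \<in> S \<Longrightarrow> F l = G l"
  shows "log_deriv c F = log_deriv c G" "dressed_nilp c P F = dressed_nilp c P G"
proof -
  have ev: "\<forall>\<^sub>F l in nhds c. F l $ i $ j = G l $ i $ j" for i j
    unfolding eventually_nhds using assms by (intro exI[of _ S]) auto
  have "deriv (\<lambda>l. F l $ i $ j) c = deriv (\<lambda>l. G l $ i $ j) c" for i j
    by (rule deriv_cong_ev[OF ev refl])
  then show *: "log_deriv c F = log_deriv c G"
    using assms by (simp add: log_deriv_def)
  show "dressed_nilp c P F = dressed_nilp c P G"
    using assms by (simp add: dressed_nilp_def *)
qed

text \<open>Comparing Lax forms instead of B and C leaves room for different diagonals.\<close>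

lemma lax_solution_cong:
  assumes F: "lax_solution V B F" and V: "open V" and eq: "\<And>x. x \<in> V \<Longrightarrow> F x = G x"
    and B: "\<And>x l h. x \<in> V \<Longrightarrow> lax_form B l x h = lax_form C l x h"
  shows "lax_solution V C G"
proof -
  have "((\<lambda>y. G y l) has_derivative (\<lambda>h. G x l ** lax_form C l x h)) (at x)" if x: "x \<in> V" for x l
    using has_derivative_transform_within_open[OF lax_solution_has_derivative[OF F x] V x, of l "\<lambda>y. G y l"]
    by (simp add: eq B x)
  then show ?thesis
    using F eq unfolding lax_solution_def by auto
qed

theorem proposition7p3:
  fixes U V :: "(real^'n::finite) set"
    and k :: nat
    and \<beta> \<beta>hat Nt Nt' :: "real^'n \<Rightarrow> complex^'n^'n"
    and E Et Ehat :: "real^'n \<Rightarrow> complex \<Rightarrow> complex^'n^'n"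
    and \<alpha> :: real
    and a :: complex
    and N N' :: "complex^'n^'n"
  assumes U: "open U" "connected U" "0 \<in> U"
    and k: "k \<ge> 1"
    and \<beta>: "gl_o_solution k U \<beta>"
    and E: "is_frame U \<beta> E"
    and \<alpha>: "\<alpha> \<noteq> 0" and a: "a = complex_of_real \<alpha>"
    and N: "N ** N = 0" "\<forall>i j. cnj (N $ i $ j) = N $ i $ j"
    and N'_well_defined: "invertible (mat 1 + (1 / (4 * \<alpha>\<^sup>2)) *\<^sub>R (transpose N ** N))"
    and N': "N' = partner \<alpha> N"
    and Nt: "\<forall>x. Nt x = dressed_nilp a N (E x)"
    and Et: "\<forall>x. Et x = dressed_frame a N (E x)"
    and Nt': "\<forall>x. Nt' x = dressed_nilp (- a) N' (Et x)"
    and V: "open V" "V \<subseteq> U"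
    and Nt_well_defined: "\<forall>x\<in>V. invertible (mat 1 + N ** log_deriv a (E x))"
    and Nt'_well_defined: "\<forall>x\<in>V. invertible (mat 1 + N' ** log_deriv (- a) (Et x))"
    and \<beta>hat: "\<forall>x. \<beta>hat x = \<beta> x - off_diag (Nt x + Nt' x)"
    and Ehat: "\<forall>x. Ehat x = dress (dressing_elem \<alpha> N) (E x)"
  shows "gl_o_solution k V \<beta>hat \<and>
    (\<forall>x\<in>V. dressing_factorization (dressing_elem \<alpha> N) (E x) (Ehat x)
       (\<lambda>l. simple_elem (- a) (Nt' x) l ** simple_elem a (Nt x) l)) \<and>
    (\<forall>x\<in>V. \<forall>l. l \<noteq> a \<and> l \<noteq> - a \<longrightarrow>
       Ehat x l = simple_elem (- a) N' l ** simple_elem a N l ** E x l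
         ** matrix_inv (simple_elem a (Nt x) l) ** matrix_inv (simple_elem (- a) (Nt' x) l)) \<and>
    has_lax_form V \<beta>hat Ehat"
proof -
  have a0: "a \<noteq> 0" "a \<noteq> - a" "- a \<noteq> a" and cnj_a: "cnj a = a"
    using \<alpha> by (simp_all add: a eq_neg_iff_add_eq_0 neg_eq_iff_add_eq_0)
  have N'N': "N' ** N' = 0"
    unfolding N' by (rule partner_eqs(1)[OF \<alpha> N(1) N'_well_defined])
  have cnj_N: "cnj_mat N = N"
    using N(2) by (simp add: vec_eq_iff)
  have cnj_N': "cnj_mat N' = N'"
    unfolding N' by (rule cnj_mat_partner[OF cnj_N N'_well_defined])
  have \<beta>C: "C_class k U \<beta>"
    and \<beta>_real: "\<And>x i j. x \<in> U \<Longrightarrow> \<beta> x $ i $ j \<in> \<real>"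
    and \<beta>_sym: "\<And>x. x \<in> U \<Longrightarrow> transpose (\<beta> x) = \<beta> x"
    and \<beta>_diag: "\<And>x i. x \<in> U \<Longrightarrow> \<beta> x $ i $ i = 0"
    and \<beta>_flat: "\<And>x i j. x \<in> U \<Longrightarrow> commutator (elem_diag i) (partial_deriv j \<beta> x)
          - commutator (elem_diag j) (partial_deriv i \<beta> x)
        = commutator (commutator (elem_diag i) (\<beta> x)) (commutator (elem_diag j) (\<beta> x))"
    using \<beta> unfolding gl_o_solution_def by blast+
  have cnj_\<beta>: "cnj_mat (\<beta> x) = \<beta> x" if "x \<in> U" for x
    using \<beta>_real[OF that] by (simp add: vec_eq_iff Reals_cnj_iff)
  have \<beta>CV: "C_class k V \<beta>"
    by (rule C_class_subset[OF \<beta>C V(2)])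
  have E_GL: "\<And>x. x \<in> U \<Longrightarrow> entire_GL (E x)" and E0: "\<And>l. E 0 l = mat 1"
    using E unfolding is_frame_def by blast+
  have E_lax: "lax_solution U \<beta> E"
    using E E_GL has_lax_form_iff[of U E \<beta>] unfolding is_frame_def by blast
  have E_laxV: "lax_solution V \<beta> E"
    using E_lax V(2) unfolding lax_solution_def by blast

  \<comment> \<open>First dressing step, at the pole a\<close>
  define F1 where "F1 = (\<lambda>x. nilpotent_dressing.ext a N (E x))"
  have nd1: "nilpotent_dressing a N (E x)" if "x \<in> V" for x
    using E_GL N(1) Nt_well_defined that V(2) by (auto simp: nilpotent_dressing_def)
  have cont\<beta>: "continuous_on V \<beta>"
    using C_class_le[OF \<beta>CV, of 0] by simp
  have inv1: "invertible (mat 1 + N ** log_deriv a (E y))" if "y \<in> V" for y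
    using Nt_well_defined that by blast
  have F1_lax: "lax_solution V (\<lambda>x. \<beta> x - Nt x) F1"
    unfolding F1_def using dressed_lax_solution[OF V(1) cont\<beta> E_laxV N(1) inv1] by (simp add: Nt)
  have dNt: "(Nt has_derivative
      (\<lambda>h. commutator (Nt x) (lax_form \<beta> a x h) - Nt x ** dg h ** Nt x)) (at x)" if "x \<in> V" for x
    using dressed_nilp_has_derivative[OF V(1) that cont\<beta> E_laxV inv1] Nt by (simp add: Nt[rule_format, abs_def])
  have NtNt: "Nt x ** Nt x = 0" if "x \<in> V" for x
    using nilpotent_dressing.dressed_nilp_square[OF nd1[OF that]] by (simp add: Nt)
  have NtC: "C_class k V Nt"
    by (rule C_class_bootstrap[OF V(1) \<beta>CV dNt])
  define B1 where "B1 = (\<lambda>x. \<beta> x - Nt x)"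
  have B1C: "C_class k V B1"
    unfolding B1_def by (rule C_class_diff[OF V(1) \<beta>CV NtC])
  have contB1: "continuous_on V B1"
    using C_class_le[OF B1C, of 0] by simp
  \<comment> \<open>The two may differ at a, where \<open>dressed_frame\<close> is spurious; as a is
    not -a, they share their germ at the second pole.\<close>
  have Et_F1: "Et x l = F1 x l" if "x \<in> V" "l \<in> - {a}" for x l
    using nilpotent_dressing.ext_eq[OF nd1[OF that(1)], of l] that(2) by (simp add: Et F1_def)
  have open_a: "open (- {a})" "- a \<in> - {a}"
    using a0 by auto
  have log_F1: "log_deriv (- a) (Et x) = log_deriv (- a) (F1 x)"
    and Nt'_F1: "Nt' x = dressed_nilp (- a) N' (F1 x)" if "x \<in> V" for x
    using dressed_nilp_cong[OF open_a Et_F1[OF that]] by (simp_all add: Nt')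
  have inv2: "invertible (mat 1 + N' ** log_deriv (- a) (F1 y))" if "y \<in> V" for y
    using Nt'_well_defined log_F1 that by force

  \<comment> \<open>Second dressing step, at the pole -a\<close>
  define F2 where "F2 = (\<lambda>x. nilpotent_dressing.ext (- a) N' (F1 x))"
  have F1_lax': "lax_solution V B1 F1"
    using F1_lax by (simp add: B1_def)
  have nd2: "nilpotent_dressing (- a) N' (F1 x)" if "x \<in> V" for x
    using F1_lax' N'N' inv2 that by (auto simp: nilpotent_dressing_def lax_solution_def)
  define B2 where "B2 = (\<lambda>x. B1 x - Nt' x)"
  have "lax_solution V (\<lambda>x. B1 x - dressed_nilp (- a) N' (F1 x)) F2"
    unfolding F2_def by (rule dressed_lax_solution[OF V(1) contB1 F1_lax' N'N' inv2])
  then have F2_lax: "lax_solution V B2 F2"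
    by (rule lax_solution_cong[OF _ V(1) refl]) (simp add: lax_form_eq Nt'_F1 B2_def)
  have dNt': "(Nt' has_derivative
      (\<lambda>h. commutator (Nt' x) (lax_form B1 (- a) x h) - Nt' x ** dg h ** Nt' x)) (at x)" if x: "x \<in> V" for x
    by (rule has_derivative_transform_within_open[OF _ V(1) x Nt'_F1[symmetric]])
      (use dressed_nilp_has_derivative[OF V(1) x contB1 F1_lax' inv2] Nt'_F1[OF x] in simp_all)
  have Nt'Nt': "Nt' x ** Nt' x = 0" if "x \<in> V" for x
    using nilpotent_dressing.dressed_nilp_square[OF nd2[OF that]] by (simp add: Nt'_F1[OF that])
  have Nt'C: "C_class k V Nt'"
    by (rule C_class_bootstrap[OF V(1) B1C dNt'])

  \<comment> \<open>The two steps as a dressing factorization\<close>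
  define s where "s = (\<lambda>l. simple_elem (- a) N' l ** simple_elem a N l)"
  have s: "dressing_elem \<alpha> N = s"
    by (auto simp: s_def dressing_elem_def a N')
  define sh where "sh = (\<lambda>x l. simple_elem (- a) (Nt' x) l ** simple_elem a (Nt x) l)"
  have F2_eq: "F2 x l = s l ** E x l ** matrix_inv (simple_elem a (Nt x) l) ** matrix_inv (simple_elem (- a) (Nt' x) l)"
    if x: "x \<in> V" and l: "l \<noteq> a" "l \<noteq> - a" for x l
  proof -
    have "F2 x l = simple_elem (- a) N' l ** F1 x l ** simple_elem (- a) (- Nt' x) l"
      unfolding F2_def Nt'_F1[OF x] by (rule nilpotent_dressing.ext_eq_simple[OF nd2[OF x] l(2)])
    moreover have "F1 x l = simple_elem a N l ** E x l ** simple_elem a (- Nt x) l"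
      using nilpotent_dressing.ext_eq_simple[OF nd1[OF x] l(1)] by (simp add: F1_def Nt)
    ultimately show ?thesis
      by (simp add: simple_elem_inverse(3) NtNt[OF x] Nt'Nt'[OF x] s_def matrix_mul_assoc)
  qed
  have factor: "s l ** E x l = F2 x l ** sh x l" if x: "x \<in> V" and l: "l \<notin> {a, - a}" for x l
    using l simple_elem_inverse(2)[OF NtNt[OF x]] simple_elem_inverse(2)[OF Nt'Nt'[OF x]]
    by (simp add: F2_eq[OF x] sh_def matrix_mul_assoc[symmetric] matrix_inv_mult_cancel matrix_inv_works)
  have F2_GL: "entire_GL (F2 x)" if "x \<in> V" for x
    using F2_lax that by (simp add: lax_solution_def)
  have rat_sh: "rational_normalized (sh x)" for x
    unfolding sh_def by (intro rational_normalized_mult rational_normalized_simple_elem)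
  have fact: "dressing_factorization (dressing_elem \<alpha> N) (E x) (F2 x) (sh x)" if x: "x \<in> V" for x
    unfolding dressing_factorization_def s
  proof (intro conjI exI[of _ "{a, - a}"] allI impI)
    show "rational_normalized s"
      unfolding s_def by (intro rational_normalized_mult rational_normalized_simple_elem)
    show "entire_GL (E x)"
      using E_GL V(2) x by blast
    show "s l ** E x l = F2 x l ** sh x l" if "l \<notin> {a, - a}" for l
      by (rule factor[OF x that])
  qed (simp_all add: F2_GL[OF x] rat_sh)
  have Ehat_F2: "Ehat x = F2 x" if "x \<in> V" for x
    using dress_eqI[OF fact[OF that]] Ehat by simp

  \<comment> \<open>Reality and symmetry of the residue at infinity\<close>
  have sh_lim: "(sh x \<longlongrightarrow> mat 1) at_infinity" for x
    using rat_sh by (simp add: rational_normalized_def)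
  \<comment> \<open>The sum is read off from values of \<open>sh x\<close> away from both poles,
    because uniqueness of the factorization identifies the right factors only there. The pair at
    negative points is for transposition, which exchanges the poles.\<close>
  have sum_eq: "Nt x + Nt' x
      = cscale (3 * a) (sh x (- (2 * a)) - mat 1) - cscale (8 * a) (sh x (- (3 * a)) - mat 1)"
    "Nt x + Nt' x = cscale (8 * a) (sh x (3 * a) - mat 1) - cscale (3 * a) (sh x (2 * a) - mat 1)" for x
    using simple_elem_pair_sum[of "- a" "Nt' x" "Nt x"] a0(1) by (simp_all add: sh_def add.commute)
  have points: "2 * a \<notin> {a, - a}" "3 * a \<notin> {a, - a}" "- (2 * a) \<notin> {a, - a}" "- (3 * a) \<notin> {a, - a}"
    using \<alpha> by (auto simp: a complex_eq_iff)
  have E_orth: "E x l ** transpose (E x (- l)) = mat 1" if "x \<in> U" for x l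
    by (rule lax_solution_orthogonal[OF U \<beta>_sym E_lax E0 lax_solution_has_derivative[OF E_lax] E0 that])
  have E_cnj: "cnj_mat (E x (cnj l)) = E x l" if x: "x \<in> U" for x l
  proof -
    \<comment> \<open>The conjugated frame inverts the same matrix as E, so uniqueness of inverses
      does the work of a uniqueness theorem for the linear system.\<close>
    have "cnj_mat (E x (cnj l)) ** transpose (E x (- l)) = mat 1"
    proof (rule lax_solution_orthogonal[OF U \<beta>_sym E_lax E0 _ _ x])
      show "((\<lambda>y. cnj_mat (E y (cnj l))) has_derivative
          (\<lambda>h. cnj_mat (E x (cnj l)) ** lax_form \<beta> l x h)) (at x)" if "x \<in> U" for x
        using bounded_linear.has_derivative[OF bounded_linear_cnj_mat
            lax_solution_has_derivative[OF E_lax that, of "cnj l"]]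
        by (simp add: cnj_mat_simps cnj_mat_lax_form[of \<beta> x, OF cnj_\<beta>[OF that]])
      show "cnj_mat (E 0 (cnj l)) = mat 1"
        by (simp add: E0 cnj_mat_simps)
    qed
    then have "matrix_inv (transpose (E x (- l))) = cnj_mat (E x (cnj l))"
      using matrix_inv_unique(3,4) by blast
    moreover have "matrix_inv (transpose (E x (- l))) = E x l"
      using matrix_inv_unique(3,4) E_orth[OF x] by blast
    ultimately show ?thesis by simp
  qed
  have sum_real: "cnj_mat (Nt x + Nt' x) = Nt x + Nt' x" if x: "x \<in> V" for x
  proof -
    define sc where "sc = (\<lambda>l. simple_elem (- a) (cnj_mat (Nt' x)) l ** simple_elem a (cnj_mat (Nt x)) l)"
    have sc: "cnj_mat (sh x (cnj l)) = sc l" for l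
      by (simp add: sh_def sc_def cnj_mat_simps cnj_mat_simple_elem cnj_a)
    have s_cnj: "cnj_mat (s (cnj l)) = s l" for l
      by (simp add: s_def cnj_mat_simps cnj_mat_simple_elem cnj_a cnj_N cnj_N')
    have "rational_normalized sc"
      unfolding sc_def by (intro rational_normalized_mult rational_normalized_simple_elem)
    then have sc_lim: "(sc \<longlongrightarrow> mat 1) at_infinity"
      by (simp add: rational_normalized_def)
    have eq: "F2 x l ** sh x l = cnj_mat (F2 x (cnj l)) ** sc l" if l: "l \<notin> {a, - a}" for l
    proof -
      have "cnj l \<notin> {a, - a}"
        using l cnj_a by (metis complex_cnj_cnj complex_cnj_minus insert_iff singleton_iff)
      then have "cnj_mat (F2 x (cnj l) ** sh x (cnj l)) = cnj_mat (s (cnj l) ** E x (cnj l))"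
        using factor[OF x] by simp
      then have "cnj_mat (F2 x (cnj l)) ** sc l = s l ** E x l"
        using E_cnj x V(2) by (auto simp: cnj_mat_simps sc s_cnj)
      then show ?thesis
        using factor[OF x l] by simp
    qed
    have sh_sc: "sh x l = sc l" if "l \<notin> {a, - a}" for l
      by (rule factorization_unique(2)[OF F2_GL[OF x] entire_GL_cnj[OF F2_GL[OF x]] sh_lim sc_lim _ eq that]) simp
    have "cnj_mat (Nt x) + cnj_mat (Nt' x)
        = cscale (8 * a) (sc (3 * a) - mat 1) - cscale (3 * a) (sc (2 * a) - mat 1)"
      using simple_elem_pair_sum(2)[of "- a" "cnj_mat (Nt' x)" "cnj_mat (Nt x)"] a0(1)
      by (simp add: sc_def add.commute)
    also have "\<dots> = Nt x + Nt' x"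
      by (simp only: sum_eq(2) sh_sc points not_False_eq_True)
    finally show ?thesis
      by (simp only: cnj_mat_simps)
  qed
  have sum_sym: "transpose (Nt x + Nt' x) = Nt x + Nt' x" if x: "x \<in> V" for x
  proof -
    \<comment> \<open>\<open>st\<close> is the image of \<open>sh x\<close> under inverting the
      transpose at -l: nilpotency of the residues makes the inverse a change of sign, and reflection
      exchanges the poles.\<close>
    define st where "st = (\<lambda>l. simple_elem a (transpose (Nt' x)) l ** simple_elem (- a) (transpose (Nt x)) l)"
    have tt: "transpose (Nt x) ** transpose (Nt x) = 0" "transpose (Nt' x) ** transpose (Nt' x) = 0"
      by (simp_all add: matrix_transpose_mul[symmetric] NtNt[OF x] Nt'Nt'[OF x] transpose_simps)
    have sh_st: "transpose (sh x (- l)) ** st l = mat 1" for l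
    proof -
      have "transpose (sh x (- l)) = simple_elem (- a) (- transpose (Nt x)) l ** simple_elem a (- transpose (Nt' x)) l"
        using transpose_simple_elem[of "- a" "Nt' x" l] transpose_simple_elem[of a "Nt x" l]
        by (simp add: sh_def matrix_transpose_mul)
      moreover have "simple_elem a (- transpose (Nt' x)) l ** simple_elem a (transpose (Nt' x)) l = mat 1"
        "simple_elem (- a) (- transpose (Nt x)) l ** simple_elem (- a) (transpose (Nt x)) l = mat 1"
        by (rule matrix_inv_unique(4)[OF simple_elem_inverse(1)], rule tt)+
      ultimately show ?thesis
        unfolding st_def by (metis matrix_mul_assoc matrix_mul_rid)
    qed
    have s_st: "transpose (s (- l)) ** s l = mat 1" if l: "l \<notin> {a, - a}" for l
    proof -
      have tN: "transpose N ** transpose N = 0" "transpose N' ** transpose N' = 0"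
        by (simp_all add: matrix_transpose_mul[symmetric] N N'N' transpose_simps)
      have "s l = simple_elem a (transpose N') l ** simple_elem (- a) (transpose N) l"
        using dressing_elem_eq_transposed[OF \<alpha> N(1) N'_well_defined, of l] l
        by (simp add: s[symmetric] a N')
      moreover have "transpose (s (- l)) = simple_elem (- a) (- transpose N) l ** simple_elem a (- transpose N') l"
        using transpose_simple_elem[of "- a" N' l] transpose_simple_elem[of a N l]
        by (simp add: s_def matrix_transpose_mul)
      moreover have "simple_elem a (- transpose N') l ** simple_elem a (transpose N') l = mat 1"
        "simple_elem (- a) (- transpose N) l ** simple_elem (- a) (transpose N) l = mat 1"
        by (rule matrix_inv_unique(4)[OF simple_elem_inverse(1)], rule tN)+
      ultimately show ?thesis
        by (metis matrix_mul_assoc matrix_mul_rid)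
    qed
    have "rational_normalized st"
      unfolding st_def by (intro rational_normalized_mult rational_normalized_simple_elem)
    then have st_lim: "(st \<longlongrightarrow> mat 1) at_infinity"
      by (simp add: rational_normalized_def)
    have eq: "F2 x l ** sh x l = matrix_inv (transpose (F2 x (- l))) ** st l" if l: "l \<notin> {a, - a}" for l
    proof -
      have ml: "- l \<notin> {a, - a}"
        using l by auto
      \<comment> \<open>Both sides of the claim invert M: one by orthogonality of s and E, the other
        by the factorization at -l.\<close>
      define M where "M = transpose (s (- l) ** E x (- l))"
      have "E x l ** transpose (E x (- l)) = mat 1"
        using E_orth x V(2) by blast
      then have "transpose (E x (- l)) ** E x l = mat 1"
        by (rule matrix_inv_unique(4))
      then have "M ** (s l ** E x l) = mat 1"
        unfolding M_def matrix_transpose_mul using s_st[OF l] by (metis matrix_mul_assoc matrix_mul_rid)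
      then have 1: "matrix_inv M = s l ** E x l"
        by (rule matrix_inv_unique(3))
      have inv: "invertible (transpose (F2 x (- l)))"
        using F2_GL[OF x] by (intro invertible_transpose) (simp add: entire_GL_def)
      have "M = transpose (sh x (- l)) ** transpose (F2 x (- l))"
        unfolding M_def factor[OF x ml] by (rule matrix_transpose_mul)
      then have "M ** (matrix_inv (transpose (F2 x (- l))) ** st l) = mat 1"
        by (simp add: matrix_mul_assoc[symmetric] matrix_inv_mult_cancel[OF inv] sh_st)
      then have "matrix_inv M = matrix_inv (transpose (F2 x (- l))) ** st l"
        by (rule matrix_inv_unique(3))
      with 1 show ?thesis
        using factor[OF x l] by simp
    qed
    have sh_eq: "sh x l = st l" if "l \<notin> {a, - a}" for l
      by (rule factorization_unique(2)[OF F2_GL[OF x] entire_GL_inv_transpose[OF F2_GL[OF x]] sh_lim st_lim _ eq that]) simp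
    have "transpose (Nt' x) + transpose (Nt x)
        = cscale (3 * a) (st (- (2 * a)) - mat 1) - cscale (8 * a) (st (- (3 * a)) - mat 1)"
      unfolding st_def by (rule simple_elem_pair_sum(2)[OF a0(1)])
    also have "\<dots> = Nt x + Nt' x"
      by (simp only: sum_eq(1) sh_eq points not_False_eq_True)
    finally show ?thesis
      by (simp only: transpose_simps add.commute)
  qed

  \<comment> \<open>The nonlinear system and the linear system for the dressed solution\<close>
  have B2_flat: "commutator (elem_diag i) (partial_deriv j \<beta> x - partial_deriv j Nt x - partial_deriv j Nt' x)
      - commutator (elem_diag j) (partial_deriv i \<beta> x - partial_deriv i Nt x - partial_deriv i Nt' x)
    = commutator (commutator (elem_diag i) (B2 x)) (commutator (elem_diag j) (B2 x))"
    if x: "x \<in> V" for x i j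
  proof -
    have xU: "x \<in> U"
      using x V(2) by blast
    have comm: "elem_diag i ** elem_diag j = elem_diag j ** (elem_diag i :: complex^'n^'n)"
      unfolding dg_axis[symmetric] by (rule dg_commute)
    have 1: "partial_deriv m Nt x = commutator (Nt x) (cscale a (elem_diag m) + commutator (elem_diag m) (\<beta> x))
        - Nt x ** elem_diag m ** Nt x" for m
      by (simp add: partial_deriv_eq[OF dNt[OF x]] lax_form_eq dg_axis)
    have 2: "partial_deriv m Nt' x
        = commutator (Nt' x) (cscale (- a) (elem_diag m) + commutator (elem_diag m) (B1 x))
        - Nt' x ** elem_diag m ** Nt' x" for m
      by (simp only: partial_deriv_eq[OF dNt'[OF x]] lax_form_eq dg_axis)
    \<comment> \<open>\<open>flatness_step\<close> treats the derivatives as plain matrices, so its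
      conclusion for B1 is literally its hypothesis for B2.\<close>
    have "commutator (elem_diag i) (partial_deriv j \<beta> x - partial_deriv j Nt x)
      - commutator (elem_diag j) (partial_deriv i \<beta> x - partial_deriv i Nt x)
      = commutator (commutator (elem_diag i) (B1 x)) (commutator (elem_diag j) (B1 x))"
      unfolding B1_def by (rule flatness_step[OF comm NtNt[OF x] \<beta>_flat[OF xU] 1 1])
    from flatness_step[OF comm Nt'Nt'[OF x] this 2 2] show ?thesis
      by (simp only: B2_def)
  qed
  have comm_hat: "commutator (dg h) (\<beta>hat x) = commutator (dg h) (B2 x)" for h x
  proof -
    have "\<beta>hat x = \<beta> x - off_diag (Nt x + Nt' x)"
      using \<beta>hat by blast
    then show ?thesis
      unfolding B2_def B1_def by (simp only: commutator_diff_right commutator_dg_off_diag)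
        (simp add: commutator_def matrix_ring_simps)
  qed
  have partial_hat: "partial_deriv j \<beta>hat x
      = partial_deriv j \<beta> x - off_diag (partial_deriv j Nt x + partial_deriv j Nt' x)" if x: "x \<in> V" for x j
  proof -
    \<comment> \<open>Here k \<ge> 1 enters: class 0 alone would give only continuity.\<close>
    have \<beta>d: "(\<beta> has_derivative frechet_derivative \<beta> (at x)) (at x)"
      using k \<beta>CV x C_class_le[of k V \<beta> 1] by (simp add: frechet_derivative_works[symmetric])
    have "((\<lambda>x. \<beta> x - off_diag (Nt x + Nt' x)) has_derivative
        (\<lambda>h. frechet_derivative \<beta> (at x) h
          - off_diag ((commutator (Nt x) (lax_form \<beta> a x h) - Nt x ** dg h ** Nt x)
            + (commutator (Nt' x) (lax_form B1 (- a) x h) - Nt' x ** dg h ** Nt' x)))) (at x)"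
      by (intro has_derivative_diff \<beta>d bounded_linear.has_derivative[OF bounded_linear_off_diag]
          has_derivative_add dNt dNt' x)
    moreover have "\<beta>hat = (\<lambda>x. \<beta> x - off_diag (Nt x + Nt' x))"
      using \<beta>hat by blast
    ultimately show ?thesis
      by (simp only: partial_deriv_eq partial_deriv_eq[OF dNt[OF x]] partial_deriv_eq[OF dNt'[OF x]]
          partial_deriv_eq[OF \<beta>d])
  qed
  have comm_partial_hat: "commutator (elem_diag i) (partial_deriv j \<beta>hat x)
      = commutator (elem_diag i) (partial_deriv j \<beta> x - partial_deriv j Nt x - partial_deriv j Nt' x)"
    if x: "x \<in> V" for x i j
    unfolding partial_hat[OF x] dg_axis[symmetric] commutator_diff_right commutator_dg_off_diag
    by (simp add: commutator_def matrix_ring_simps)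
  have "gl_o_solution k V \<beta>hat"
    unfolding gl_o_solution_def
  proof (intro conjI ballI allI)
    have "C_class k V (\<lambda>x. \<beta> x - off_diag (Nt x + Nt' x))"
      by (intro C_class_diff C_class_linear[OF _ bounded_linear_off_diag] C_class_add V(1) \<beta>CV NtC Nt'C)
    moreover have "\<beta>hat = (\<lambda>x. \<beta> x - off_diag (Nt x + Nt' x))"
      using \<beta>hat by blast
    ultimately show "C_class k V \<beta>hat"
      by (simp only:)
    fix x assume x: "x \<in> V"
    then have xU: "x \<in> U"
      using V(2) by blast
    have hx: "\<beta>hat x = \<beta> x - off_diag (Nt x + Nt' x)"
      using \<beta>hat by blast
    show "\<beta>hat x $ i $ j \<in> \<real>" for i j
    proof -
      have "cnj ((Nt x + Nt' x) $ i $ j) = (Nt x + Nt' x) $ i $ j"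
        using arg_cong[OF sum_real[OF x], of "\<lambda>A. A $ i $ j"] by simp
      then show ?thesis
        using \<beta>_real[OF xU, of i j] by (simp add: hx off_diag_def Reals_cnj_iff)
    qed
    show "transpose (\<beta>hat x) = \<beta>hat x"
    proof -
      have "transpose (off_diag A) = off_diag (transpose A)" for A :: "complex^'n^'n"
        by (simp add: vec_eq_iff transpose_def off_diag_def)
      then show ?thesis
        unfolding hx transpose_simps(2) \<beta>_sym[OF xU] by (simp only: sum_sym[OF x])
    qed
    show "\<beta>hat x $ i $ i = 0" for i
      by (simp add: hx off_diag_def \<beta>_diag[OF xU])
    show "commutator (elem_diag i) (partial_deriv j \<beta>hat x) - commutator (elem_diag j) (partial_deriv i \<beta>hat x)
        = commutator (commutator (elem_diag i) (\<beta>hat x)) (commutator (elem_diag j) (\<beta>hat x))" for i j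
      unfolding comm_partial_hat[OF x] B2_flat[OF x] by (simp only: dg_axis[symmetric] comm_hat)
  qed
  moreover have "dressing_factorization (dressing_elem \<alpha> N) (E x) (Ehat x)
       (\<lambda>l. simple_elem (- a) (Nt' x) l ** simple_elem a (Nt x) l)" if "x \<in> V" for x
    using fact[OF that] by (simp add: Ehat_F2[OF that] sh_def)
  moreover have "Ehat x l = simple_elem (- a) N' l ** simple_elem a N l ** E x l
         ** matrix_inv (simple_elem a (Nt x) l) ** matrix_inv (simple_elem (- a) (Nt' x) l)"
    if "x \<in> V" "l \<noteq> a" "l \<noteq> - a" for x l
    using F2_eq[OF that] by (simp add: Ehat_F2[OF that(1)] s_def)
  moreover have "has_lax_form V \<beta>hat Ehat"
  proof -
    have "lax_solution V \<beta>hat Ehat"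
      by (rule lax_solution_cong[OF F2_lax V(1)]) (simp_all add: Ehat_F2 lax_form_eq comm_hat)
    moreover from this have "\<forall>x\<in>V. entire_GL (Ehat x)"
      unfolding lax_solution_def by blast
    ultimately show ?thesis
      using has_lax_form_iff by blast
  qed
  ultimately show ?thesis
    by blast
qed

end
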